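(* Let $\mathbf a=\{a_1,\dots,a_A\}$, $\mathbf c=\{c_1,\dots,c_C\}$ be lists of complex numbers ($A,C\in\mathbb N_0$, not both zero), $\mathbf d=\{d_1,d_2\}$ with $d_1,d_2\in\mathbb C\setminus\{0\}$, $\sigma\in(0,\infty)$, $f\in\mathbb C\setminus\{0\}$, $z=e^{i\psi}$, such that $|c_k|<\sigma$ for all $k$, $|d_1|,|d_2|<1/\sigma$, $c_kd_l\notin\Omega_q$ for all $k,l$, $d_1/d_2,d_2/d_1\notin\Omega_q$, and $f,\ fd_1/d_2\notin\{q^m:m\in\mathbb Z\}$. Define $$H(\mathbf a,\mathbf c,\mathbf d;q):=\mathop{\mathrm{Sym}}_{d_1;d_2}\frac{(d_1\mathbf a;q)_\infty}{(d_2/d_1,d_1\mathbf c;q)_\infty}\,{}_{C}\phi_{A+1}^{\,C-A-2}\!\left(\begin{matrix}d_1\mathbf c\\ d_1\mathbf a,\ qd_1/d_2\end{matrix};q,q\right).$$ Then $$\int_{-\pi}^{\pi}\frac{\big((fd_1,\tfrac{q}{f}d_2)\tfrac{\sigma}{z},(\tfrac{f}{d_2},\tfrac{q}{fd_1},\mathbf a)\tfrac{z}{\sigma};q\big)_\infty}{\big((d_1,d_2)\tfrac{\sigma}{z},\mathbf c\tfrac{z}{\sigma};q\big)_\infty}\,d\psi=\frac{2\pi\,\vartheta(f,fd_1/d_2;q)}{(q;q)_\infty}H(\mathbf a,\mathbf c,\mathbf d;q).$$ Moreover, if $C\ge A+2$, $c_k/c_{k'}\notin\Omega_q$ for $k\ne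 k'$, and (in case $C=A+2$) $|qa_1\cdots a_A|<|d_1d_2c_1\cdots c_C|$, then the same integral equals $\frac{2\pi}{(q;q)_\infty}J(\mathbf a,\mathbf c,\mathbf d;f,q)$, where $$J(\mathbf a,\mathbf c,\mathbf d;f,q):=\sum_{k=1}^C\frac{\vartheta(fc_kd_1,\tfrac{f}{c_kd_2};q)\,(\mathbf a/c_k;q)_\infty}{(c_kd_1,c_kd_2,\mathbf c_{[k]}/c_k;q)_\infty}\,{}_{A+2}\phi_{C-1}\!\left(\begin{matrix}c_kd_1,c_kd_2,\ qc_k/\mathbf a\\ qc_k/\mathbf c_{[k]}\end{matrix};q,\frac{q(qc_k)^{C-A-2}a_1\cdots a_A}{d_1d_2c_1\cdots c_C}\right).$$
   Context: $q\in\mathbb C$, $0<|q|<1$. $(a;q)_n$, $(a;q)_\infty$ are the finite/infinite $q$-shifted factorials, $(a_1,\dots,a_k;q)_\infty=\prod_i(a_i;q)_\infty$; a list $\mathbf a$ as an entry stands for all its elements; $x\mathbf a=\{xa_i\}$, $\mathbf a/x=\{a_i/x\}$, $x/\mathbf a=\{x/a_i\}$, $\mathbf c_{[k]}=\mathbf c$ with $c_k$ removed; $(\mathbf u\,y;q)_\infty$ with $\mathbf u$ a list means $\prod_i(u_iy;q)_\infty$. $\Omega_q=\{q^{-k}:k\in\mathbb N_0\}$. $\vartheta(x;q)=(x,q/x;q)_\infty$ and $\vartheta(x_1,\dots,x_k;q)=\prod_i\vartheta(x_i;q)$. $\mathop{\mathrm{Sym}}_{d_1;d_2}F(d_1,d_2)=F(d_1,d_2)+F(d_2,d_1)$.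 ${}_{r+1}\phi_s\!\left(\begin{smallmatrix}a_1,\dots,a_{r+1}\\ b_1,\dots,b_s\end{smallmatrix};q,z\right)=\sum_{k\ge0}\frac{(a_1,\dots,a_{r+1};q)_k}{(q,b_1,\dots,b_s;q)_k}((-1)^kq^{\binom k2})^{s-r}z^k$. For $p\in\mathbb N_0$, ${}_{r+1}\phi_s^{\,-p}$ denotes ${}_{r+p+1}\phi_s$ with $p$ extra numerator parameters $0$, and ${}_{r+1}\phi_s^{\,p}$ denotes ${}_{r+1}\phi_{s+p}$ with $p$ extra denominator parameters $0$. *)

theory Defs
  imports "HOL-Analysis.Analysis"
begin

definition qinf :: "complex \<Rightarrow> complex \<Rightarrow> complex" where
  "qinf a q = (\<Prod>n. 1 - a * q ^ n)"

definition qfin :: "complex \<Rightarrow> complex \<Rightarrow> nat \<Rightarrow> complex" where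
  "qfin a q n = (\<Prod>j<n. 1 - a * q ^ j)"

definition qtheta :: "complex \<Rightarrow> complex \<Rightarrow> complex" where
  "qtheta x q = qinf x q * qinf (q / x) q"

definition Omega_q :: "complex \<Rightarrow> complex set" where
  "Omega_q q = {(inverse q) ^ k | k. True}"

definition qZ :: "complex \<Rightarrow> complex set" where
  "qZ q = {q powi m | m. True}"

(* One half F(d1,d2) of the symmetrization defining H(a,c,d;q):
     (d1 a;q)_\<infinity> / (d2/d1, d1 c;q)_\<infinity> *
       C phi_{A+1}^{C-A-2} (d1 c ; d1 a, q d1/d2 ; q, q).
   After adjoining the |C-A-2| zero parameters, the numerator count r+1 and the
   denominator count s satisfy s = r, so the factor ((-1)^k q^(k choose 2))^(s-r)
   is 1 and zero parameters contribute (0;q)_k = 1.  The quotient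
   (d1 a;q)_\<infinity> / (d1 a;q)_k is written as (d1 a q^k;q)_\<infinity>, which is its
   value (and the only meaningful reading when some d1 a_i lies in Omega_q). *)
definition Hhalf :: "complex list \<Rightarrow> complex list \<Rightarrow> complex \<Rightarrow> complex \<Rightarrow> complex \<Rightarrow> complex" where
  "Hhalf a c d1 d2 q =
     (\<Sum>k. (\<Prod>x\<leftarrow>a. qinf (d1 * x * q ^ k) q) * (\<Prod>x\<leftarrow>c. qfin (d1 * x) q k)
            / (qfin q q k * qfin (q * d1 / d2) q k) * q ^ k)
     / (qinf (d2 / d1) q * (\<Prod>x\<leftarrow>c. qinf (d1 * x) q))"

definition Hfun :: "complex list \<Rightarrow> complex list \<Rightarrow> complex \<Rightarrow> complex \<Rightarrow> complex \<Rightarrow> complex" where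
  "Hfun a c d1 d2 q = Hhalf a c d1 d2 q + Hhalf a c d2 d1 q"

(* J(a,c,d;f,q), used only when C \<ge> A+2 (so C-A-2 is a natural number).
   In the series A+2 phi_{C-1}, the product (q c_k/a_i;q)_n times the factor a_i^n
   coming from the argument is written as \<Prod>_{j<n} (a_i - c_k q^(j+1)). *)
definition Jfun :: "complex list \<Rightarrow> complex list \<Rightarrow> complex \<Rightarrow> complex \<Rightarrow> complex \<Rightarrow> complex \<Rightarrow> complex" where
  "Jfun a c d1 d2 f q =
     (let C = length c; A = length a; p = C - A - 2 in
      \<Sum>k<C. (let ck = c ! k; I = {..<C} - {k} in
        qtheta (f * ck * d1) q * qtheta (f / (ck * d2)) q * (\<Prod>x\<leftarrow>a. qinf (x / ck) q)
        / (qinf (ck * d1) q * qinf (ck * d2) q * (\<Prod>j\<in>I. qinf (c ! j / ck) q))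
        * (\<Sum>n. qfin (ck * d1) q n * qfin (ck * d2) q n
                 * (\<Prod>x\<leftarrow>a. \<Prod>j<n. x - ck * q ^ (j + 1))
                 / (qfin q q n * (\<Prod>j\<in>I. qfin (q * ck / c ! j) q n))
                 * ((-1) ^ n * q ^ (n choose 2)) ^ p
                 * (q * (q * ck) ^ p / (d1 * d2 * prod_list c)) ^ n)))"

definition integrand :: "complex list \<Rightarrow> complex list \<Rightarrow> complex \<Rightarrow> complex \<Rightarrow> real \<Rightarrow> complex \<Rightarrow> complex \<Rightarrow> real \<Rightarrow> complex" where
  "integrand a c d1 d2 \<sigma> f q \<psi> =
     (let z = exp (\<i> * complex_of_real \<psi>); s = complex_of_real \<sigma> in
       qinf (f * d1 * s / z) q * qinf (q / f * d2 * s / z) q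
       * qinf (f / d2 * z / s) q * qinf (q / (f * d1) * z / s) q
       * (\<Prod>x\<leftarrow>a. qinf (x * z / s) q)
       / (qinf (d1 * s / z) q * qinf (d2 * s / z) q * (\<Prod>x\<leftarrow>c. qinf (x * z / s) q)))"

end

theory Submission
  imports Defs "HOL-Complex_Analysis.Complex_Analysis"
begin

text \<open>
  Put \<open>w = z / \<sigma>\<close>. Up to a theta quotient the integrand is a ratio of products of \<open>(x w; q)\<^sub>\<infinity>\<close> and
  \<open>(x / w; q)\<^sub>\<infinity>\<close>, so replacing \<open>w\<close> by \<open>q w\<close> multiplies it by an elementary rational function.
  Near the origin this factor tends to \<open>q\<close>, hence the circle integrals decay geometrically as
  the circle shrinks to \<open>0\<close>, and the integral is the sum of the residues at the simple poles
  \<open>d\<^sub>l q\<^sup>k\<close>; this is \<open>H\<close>. Expanding the circle to infinity instead, i.e. using the variable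
  \<open>1 / w\<close>, collects the residues at \<open>1 / w = c\<^sub>k q\<^sup>n\<close>; the factor now tends to \<open>0\<close> if \<open>C > A + 2\<close> and
  to \<open>q a\<^sub>1 \<dots> a\<^sub>A / (d\<^sub>1 d\<^sub>2 c\<^sub>1 \<dots> c\<^sub>C)\<close> if \<open>C = A + 2\<close>; this is \<open>J\<close>. Exchanging
  \<open>w\<close> and \<open>1 / w\<close> makes both computations instances of the same residue expansion of a theta quotient.
\<close>

section \<open>Simple poles along geometric progressions\<close>

text \<open>Induction on the set of poles. Subtracting the principal part
  \<open>res p / (u - p)\<close> leaves a removable singularity at \<open>p\<close>, so the
  induction hypothesis applies to the extended function. The principal part itself integrates to
  \<open>2 * pi * \<i> * res p\<close> over the outer circle and to 0 over the inner one, which does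
  not enclose \<open>p\<close>.\<close>

lemma annulus_residue_sum:
  fixes F :: "complex \<Rightarrow> complex"
  assumes "finite P" and r: "0 < r" "r < R" and "open S"
    and "\<And>u. r \<le> norm u \<Longrightarrow> norm u \<le> R \<Longrightarrow> u \<in> S"
    and "F holomorphic_on S - P"
    and "\<And>p. p \<in> P \<Longrightarrow> r < norm p \<and> norm p < R"
    and "\<And>p. p \<in> P \<Longrightarrow> ((\<lambda>u. (u - p) * F u) \<longlongrightarrow> res p) (at p)"
  shows "contour_integral (circlepath 0 R) F
           = contour_integral (circlepath 0 r) F + 2 * of_real pi * \<i> * (\<Sum>p\<in>P. res p)"
  using assms(1,5-)
proof (induction P arbitrary: F rule: finite_induct)
  case empty
  have "contour_integral (circlepath 0 R) F = contour_integral (circlepath 0 r) F"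
  proof (rule Cauchy_theorem_homotopic_loops)
    \<comment> \<open>The segment joining two points of equal angle keeps that angle, and its moduli
      are the convex combinations \<open>s\<close> of \<open>R\<close> and \<open>r\<close>; hence
      it stays in the annulus.\<close>
    show "homotopic_loops S (circlepath 0 R) (circlepath 0 r)"
    proof (rule homotopic_loops_linear)
      fix t :: real
      have eq: "circlepath 0 s t = of_real s * exp (2 * of_real pi * \<i> * of_real t)" for s
        by (simp add: circlepath)
      show "closed_segment (circlepath 0 R t) (circlepath 0 r t) \<subseteq> S"
      proof
        fix u assume "u \<in> closed_segment (circlepath 0 R t) (circlepath 0 r t)"
        then obtain l where l: "0 \<le> l" "l \<le> 1"
          and u: "u = (1 - l) *\<^sub>R circlepath 0 R t + l *\<^sub>R circlepath 0 r t"
          by (auto simp: closed_segment_def)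
        define s where "s = (1 - l) * R + l * r"
        have "u = of_real s * exp (2 * of_real pi * \<i> * of_real t)"
          by (simp add: u eq s_def scaleR_conv_of_real algebra_simps)
        then have nu: "norm u = \<bar>s\<bar>"
          by (simp add: norm_mult)
        have "s - r = (1 - l) * (R - r)" "R - s = l * (R - r)"
          by (auto simp: s_def algebra_simps)
        moreover have "(1 - l) * (R - r) \<ge> 0" "l * (R - r) \<ge> 0"
          using l r by auto
        ultimately have "r \<le> s" "s \<le> R" by (metis diff_ge_0_iff_ge)+
        with nu r empty show "u \<in> S" by auto
      qed
    qed auto
  qed (use empty \<open>open S\<close> in auto)
  then show ?case by simp
next
  case (insert p P)
  define F1 where "F1 = (\<lambda>u. F u - res p / (u - p))"
  have op: "open (S - P)"
    using \<open>open S\<close> insert.hyps by (simp add: finite_imp_closed open_Diff)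
  have pS: "p \<in> S - P"
    using insert.prems(1)[of p] insert.prems(3)[of p] insert.hyps by auto
  have eqset: "S - P - {p} = S - insert p P" by auto
  have F1h: "F1 holomorphic_on (S - P) - {p}"
    unfolding F1_def eqset by (intro holomorphic_intros insert.prems) auto
  have lim0: "((\<lambda>u. (u - p) * F1 u) \<longlongrightarrow> 0) (at p)"
  proof -
    have "((\<lambda>u. (u - p) * F u - res p) \<longlongrightarrow> res p - res p) (at p)"
      by (intro tendsto_intros insert.prems) auto
    moreover have "\<forall>\<^sub>F u in at p. (u - p) * F u - res p = (u - p) * F1 u"
      using eventually_neq_at_within[of p] by eventually_elim (simp add: F1_def right_diff_distrib)
    ultimately show ?thesis by (auto elim: Lim_transform_eventually)
  qed
  obtain g where gh: "g holomorphic_on (S - P)" and g: "\<And>z. z \<in> (S - P) - {p} \<Longrightarrow> g z = F1 z"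
    using holomorphic_on_extend_lim[OF F1h] lim0 pS op by (auto simp: interior_open)
  \<comment> \<open>The subtracted term is regular at any other pole \<open>p'\<close>, so after
    multiplication by \<open>u - p'\<close> it contributes nothing to the limit.\<close>
  have gres: "((\<lambda>u. (u - p') * g u) \<longlongrightarrow> res p') (at p')" if "p' \<in> P" for p'
  proof -
    have ne: "p' \<noteq> p" using that insert.hyps by auto
    have "((\<lambda>u. (u - p') * F u - (u - p') * (res p / (u - p))) \<longlongrightarrow>
             res p' - (p' - p') * (res p / (p' - p))) (at p')"
      by (intro tendsto_intros insert.prems) (use that ne in auto)
    moreover have "\<forall>\<^sub>F u in at p'. (u - p') * F u - (u - p') * (res p / (u - p)) = (u - p') * g u"
    proof -
      have p'S: "p' \<in> S - ((P - {p'}) \<union> {p})" using insert.prems(1)[of p'] insert.prems(3)[of p'] that ne by auto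
      have "open (S - ((P - {p'}) \<union> {p}))"
        using \<open>open S\<close> insert.hyps by (intro open_Diff finite_imp_closed) auto
      then have "\<forall>\<^sub>F u in at p'. u \<in> S - ((P - {p'}) \<union> {p}) - {p'}"
        using p'S by (rule eventually_at_in_open)
      then show ?thesis
        by eventually_elim (auto simp: g F1_def right_diff_distrib)
    qed
    ultimately show ?thesis by (auto elim: Lim_transform_eventually)
  qed
  have IH: "contour_integral (circlepath 0 R) g
           = contour_integral (circlepath 0 r) g + 2 * of_real pi * \<i> * (\<Sum>p\<in>P. res p)"
    by (rule insert.IH) (use insert.prems gh gres in auto)
  have split: "contour_integral (circlepath 0 s) F = contour_integral (circlepath 0 s) g
                 + contour_integral (circlepath 0 s) (\<lambda>u. res p / (u - p))"
    if s: "s = r \<or> s = R" for s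
  proof -
    have s0: "0 < s" "r \<le> s" "s \<le> R" using s r by auto
    have sub: "path_image (circlepath 0 s) \<subseteq> S - insert p P"
      using s0 s insert.prems(1,3) by (fastforce simp: sphere_def)
    have "contour_integral (circlepath 0 s) F
            = contour_integral (circlepath 0 s) (\<lambda>u. g u + res p / (u - p))"
      by (rule contour_integral_cong) (use sub in \<open>auto simp: g F1_def subset_iff\<close>)
    also have "\<dots> = contour_integral (circlepath 0 s) g
                 + contour_integral (circlepath 0 s) (\<lambda>u. res p / (u - p))"
    proof (rule contour_integral_add)
      show "g contour_integrable_on circlepath 0 s"
        by (rule contour_integrable_holomorphic_simple[OF gh op]) (use sub in auto)
      show "(\<lambda>u. res p / (u - p)) contour_integrable_on circlepath 0 s"
        by (rule contour_integrable_holomorphic_simple[of _ "-{p}"])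
           (use sub in \<open>auto intro!: holomorphic_intros\<close>)
    qed
    finally show ?thesis .
  qed
  have big: "contour_integral (circlepath 0 R) (\<lambda>u. res p / (u - p)) = 2 * of_real pi * \<i> * res p"
    by (rule contour_integral_unique, rule Cauchy_integral_circlepath_simple)
       (use insert.prems(3)[of p] in \<open>auto intro!: holomorphic_intros\<close>)
  have small: "contour_integral (circlepath 0 r) (\<lambda>u. res p / (u - p)) = 0"
    by (rule contour_integral_unique, rule Cauchy_theorem_convex_simple[of _ "cball 0 r"])
       (use insert.prems(3)[of p] r in \<open>auto intro!: holomorphic_intros\<close>)
  show ?case
    using IH split[of r] split[of R] big small insert.hyps by (simp add: algebra_simps)
qed

text \<open>The divisor \<open>u\<close> cancels against the derivative \<open>\<i> * u\<close> of
  the parametrised circle, leaving the factor \<open>\<i>\<close>. The rest uses periodicity to move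
  the upper half of [0, 2 pi] to [-pi, 0].\<close>

lemma contour_integral_circle_mean:
  fixes G :: "complex \<Rightarrow> complex"
  assumes "0 < \<rho>" and cont: "continuous_on (sphere 0 \<rho>) G"
  shows "contour_integral (circlepath 0 \<rho>) (\<lambda>u. G u / u)
           = \<i> * integral {-pi..pi} (\<lambda>\<psi>. G (of_real \<rho> * exp (\<i> * of_real \<psi>)))"
proof -
  define g where "g = (\<lambda>\<psi>::real. G (of_real \<rho> * exp (\<i> * of_real \<psi>)))"
  have int: "g integrable_on {x..y}" for x y
    unfolding g_def
    by (intro integrable_continuous_real continuous_on_compose2[OF cont] continuous_intros)
       (use assms(1) in \<open>auto simp: norm_mult\<close>)
  have "contour_integral (circlepath 0 \<rho>) (\<lambda>u. G u / u) = integral {0..2*pi} (\<lambda>t. \<i> * g t)"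
    unfolding circlepath_def
    by (subst contour_integral_part_circlepath_eq)
       (use assms(1) in \<open>auto simp: g_def cis_conv_exp mult_ac intro!: integral_cong\<close>)
  also have "\<dots> = \<i> * integral {0..2*pi} g" by simp
  also have "integral {0..2*pi} g = integral {0..pi} g + integral {pi..2*pi} g"
    by (rule Henstock_Kurzweil_Integration.integral_combine[symmetric]) (use int in auto)
  also have "integral {pi..2*pi} g = integral {-pi..0} (\<lambda>t. g (t + 2*pi))"
    using integral_shift_Icc_real[of "-pi" 0 g "2*pi"] by (simp add: o_def add.commute)
  also have "(\<lambda>t. g (t + 2*pi)) = g"
  proof
    fix t
    have "exp (\<i> * of_real (t + 2*pi)) = exp (\<i> * of_real t)"
      by (simp add: exp_eq distrib_left)
    then show "g (t + 2*pi) = g t" by (simp only: g_def)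
  qed
  also have "integral {0..pi} g + integral {-pi..0} g = integral {-pi..pi} g"
    by (subst add.commute, rule Henstock_Kurzweil_Integration.integral_combine) (use int in auto)
  finally show ?thesis by (simp add: g_def)
qed

text \<open>The poles accumulate at 0, so the finite residue sum is applied to annuli with shrinking
  inner circle. The hypothesis on \<open>G (q * u)\<close> is used twice: it makes the residues
  along each progression decay geometrically, and it makes the integrals over the inner circles tend
  to 0.\<close>

lemma circle_mean_eq_residue_series:
  fixes G :: "complex \<Rightarrow> complex" and R :: "complex \<Rightarrow> nat \<Rightarrow> complex"
  assumes q: "0 < norm q" "norm q < 1" and "finite E" and "0 < \<rho>"
    and E: "\<And>e. e \<in> E \<Longrightarrow> e \<noteq> 0 \<and> norm e < \<rho>"
    and inj: "\<And>e e' k k'. e \<in> E \<Longrightarrow> e' \<in> E \<Longrightarrow> e * q ^ k = e' * q ^ k' \<Longrightarrow> e = e' \<and> k = k'"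
    and "open S" and S: "\<And>u. u \<noteq> 0 \<Longrightarrow> norm u \<le> \<rho> \<Longrightarrow> u \<in> S"
    and hol: "G holomorphic_on S - {e * q ^ k |e k. e \<in> E} - {0}"
    and res: "\<And>e k. e \<in> E \<Longrightarrow> ((\<lambda>u. (u - e * q ^ k) * (G u / u)) \<longlongrightarrow> R e k) (at (e * q ^ k))"
    and "l < 1" and ratio: "\<forall>\<^sub>F u in at 0. norm (G (q * u)) \<le> l * norm (G u)"
  shows "e \<in> E \<Longrightarrow> summable (R e)"
    and "integral {-pi..pi} (\<lambda>\<psi>. G (of_real \<rho> * exp (\<i> * of_real \<psi>)))
           = 2 * of_real pi * (\<Sum>e\<in>E. \<Sum>k. R e k)"
proof -
  have q0: "q \<noteq> 0" using q by auto
  have powle: "x * norm q ^ n \<le> x" if "0 \<le> x" for x n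
    using q that by (intro mult_left_le power_le_one) auto
  obtain \<delta> where "0 < \<delta>" and \<delta>0: "\<And>u. u \<noteq> 0 \<Longrightarrow> norm u < \<delta> \<Longrightarrow> norm (G (q * u)) \<le> l * norm (G u)"
    using ratio by (auto simp: eventually_at)
  \<comment> \<open>The given \<open>l\<close> may be negative; the truncated ratio can be used in
    monotonicity arguments and as the base of a geometric majorant.\<close>
  define \<mu> where "\<mu> = max l 0"
  have \<mu>: "0 \<le> \<mu>" "\<mu> < 1" using \<open>l < 1\<close> by (auto simp: \<mu>_def)
  have \<delta>: "norm (G (q * u)) \<le> \<mu> * norm (G u)" if "u \<noteq> 0" "norm u < \<delta>" for u
    using \<delta>0[OF that] mult_right_mono[of l \<mu> "norm (G u)"] by (simp add: \<mu>_def)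
  have pow0: "(\<lambda>k. norm e * norm q ^ k) \<longlonglongrightarrow> 0" for e
    using tendsto_mult_right_zero[OF LIMSEQ_power_zero[of "norm q"]] q by simp
  \<comment> \<open>Substituting \<open>q * u\<close> for the variable in the limit at
    \<open>q * p\<close> turns it into a limit at \<open>p\<close> of
    \<open>((u - p) / u) * G (q * u)\<close>. Comparison with the limit defining the residue at
    \<open>p\<close> then gives the ratio bound, as soon as \<open>p\<close> lies within
    \<open>\<delta>\<close> of 0.\<close>
  have summ: "\<exists>N. \<forall>k\<ge>N. norm (R e (Suc k)) \<le> \<mu> * norm (R e k)" if e: "e \<in> E" for e
  proof -
    obtain N where N: "\<And>k. k \<ge> N \<Longrightarrow> norm e * norm q ^ k < \<delta>"
      using order_tendstoD(2)[OF pow0[of e] \<open>0 < \<delta>\<close>] by (auto simp: eventually_sequentially)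
    have "norm (R e (Suc k)) \<le> \<mu> * norm (R e k)" if k: "k \<ge> N" for k
    proof -
      define p where "p = e * q ^ k"
      have p: "p \<noteq> 0" "norm p < \<delta>" "e * q ^ Suc k = q * p"
        using E[OF e] q0 N[OF k] by (auto simp: p_def norm_mult norm_power)
      have l1: "((\<lambda>u. (u - p) * (G u / u)) \<longlongrightarrow> R e k) (at p)"
        using res[OF e, of k] by (simp add: p_def)
      have "filterlim (\<lambda>u. q * u) (at (q * p)) (at p)"
        unfolding filterlim_at
        by (intro conjI tendsto_intros) (use q0 in \<open>auto simp: eventually_at_filter\<close>)
      from filterlim_compose[OF _ this] res[OF e, of "Suc k"]
      have l2: "((\<lambda>u. (q * u - q * p) * (G (q * u) / (q * u))) \<longlongrightarrow> R e (Suc k)) (at p)"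
        unfolding p(3) by blast
      show ?thesis
      proof (rule tendsto_le)
        show "((\<lambda>u. \<mu> * norm ((u - p) * (G u / u))) \<longlongrightarrow> \<mu> * norm (R e k)) (at p)"
          by (intro tendsto_intros l1)
        show "((\<lambda>u. norm ((q * u - q * p) * (G (q * u) / (q * u)))) \<longlongrightarrow> norm (R e (Suc k))) (at p)"
          by (intro tendsto_intros l2)
        have "open (ball 0 \<delta> - {0 :: complex})" by auto
        then have "\<forall>\<^sub>F u in at p. u \<in> ball 0 \<delta> - {0} - {p}"
          by (rule eventually_at_in_open) (use p in auto)
        then show "\<forall>\<^sub>F u in at p. norm ((q * u - q * p) * (G (q * u) / (q * u)))
                      \<le> \<mu> * norm ((u - p) * (G u / u))"
        proof eventually_elim
          case (elim u)
          have "(q * u - q * p) * (G (q * u) / (q * u)) = ((u - p) / u) * G (q * u)"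
            using q0 elim by (simp add: field_simps)
          then have "norm ((q * u - q * p) * (G (q * u) / (q * u))) = norm ((u - p) / u) * norm (G (q * u))"
            by (simp add: norm_mult norm_divide)
          also have "\<dots> \<le> norm ((u - p) / u) * (\<mu> * norm (G u))"
            by (intro mult_left_mono \<delta>) (use elim in auto)
          also have "\<dots> = \<mu> * norm ((u - p) * (G u / u))"
            by (simp add: norm_mult norm_divide)
          finally show ?case .
        qed
      qed auto
    qed
    then show ?thesis by blast
  qed
  have abs_summ: "summable (\<lambda>k. norm (R e k))" if e: "e \<in> E" for e
  proof -
    obtain N where N: "\<And>k. k \<ge> N \<Longrightarrow> norm (R e (Suc k)) \<le> \<mu> * norm (R e k)"
      using summ[OF e] by blast
    show ?thesis by (rule summable_ratio_test[OF \<mu>(2), of N]) (use N in auto)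
  qed
  show "e \<in> E \<Longrightarrow> summable (R e)" using abs_summ summable_norm_cancel by blast

  \<comment> \<open>The circles of radius \<open>r * norm q ^ n\<close> shrink to the origin and avoid all the poles.\<close>
  define bad where "bad = (\<Union>e\<in>E. \<Union>k. \<Union>n. {norm e * norm q ^ k / norm q ^ n})"
  have "countable bad" unfolding bad_def using \<open>finite E\<close> by (intro countable_UN) (auto intro: countable_finite)
  moreover have "uncountable {0<..<min \<rho> \<delta>}"
    using \<open>0 < \<rho>\<close> \<open>0 < \<delta>\<close> by (simp add: uncountable_open_interval)
  ultimately obtain r where r: "0 < r" "r < \<rho>" "r < \<delta>" "r \<notin> bad"
    by (metis countable_subset greaterThanLessThan_iff min_less_iff_conj subsetI)
  have avoid: "norm (e * q ^ k) \<noteq> r * norm q ^ n" if "e \<in> E" for e k n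
  proof
    assume "norm (e * q ^ k) = r * norm q ^ n"
    then have "r = norm e * norm q ^ k / norm q ^ n"
      using q0 by (simp add: norm_mult norm_power field_simps)
    then show False using r that by (auto simp: bad_def)
  qed
  define F where "F = (\<lambda>u. G u / u)"
  define rn where "rn n = r * norm q ^ n" for n
  have rn: "0 < rn n" "rn n < \<rho>" for n
    using r q0 powle[of r n, THEN le_less_trans, of \<rho>] by (auto simp: rn_def)
  define poles where "poles = {e * q ^ k |e k. e \<in> E}"
  define K where "K n e = {k. rn n < norm (e * q ^ k)}" for n e
  have finK0: "finite {k. s < norm (e * q ^ k)}" if s: "0 < s" for s e
  proof -
    obtain N where "\<And>k. k \<ge> N \<Longrightarrow> norm e * norm q ^ k < s"
      using order_tendstoD(2)[OF pow0[of e] s] by (auto simp: eventually_sequentially)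
    then have "{k. s < norm (e * q ^ k)} \<subseteq> {..<N}"
      by (force simp: norm_mult norm_power not_le[symmetric])
    then show ?thesis by (rule finite_subset) auto
  qed
  have finK: "finite (K n e)" for n e unfolding K_def by (rule finK0) (rule rn)
  have fin_poles: "finite {p \<in> poles. s < norm p}" if "0 < s" for s
  proof -
    have "{p \<in> poles. s < norm p} \<subseteq> (\<lambda>(e,k). e * q ^ k) ` (SIGMA e:E. {k. s < norm (e * q ^ k)})"
      by (auto simp: poles_def image_iff)
    then show ?thesis
      by (rule finite_subset) (intro finite_imageI finite_SigmaI finK0 that \<open>finite E\<close>)
  qed
  have step: "contour_integral (circlepath 0 \<rho>) F = contour_integral (circlepath 0 (rn n)) F
           + 2 * of_real pi * \<i> * (\<Sum>e\<in>E. \<Sum>k\<in>K n e. R e k)" for n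
  proof -
    define A where "A = (SIGMA e:E. K n e)"
    define h where "h = (\<lambda>(e,k). e * q ^ k)"
    \<comment> \<open>The annulus lemma assigns residues to points, whereas \<open>R\<close> assigns
      them to pairs (e, k); injectivity of \<open>h\<close> allows the translation.\<close>
    define rs where "rs p = (case inv_into A h p of (e, k) \<Rightarrow> R e k)" for p
    have injh: "inj_on h A" using inj by (auto simp: inj_on_def A_def h_def)
    have rs: "rs (h (e, k)) = R e k" if "(e, k) \<in> A" for e k
      unfolding rs_def inv_into_f_f[OF injh that] by simp
    \<comment> \<open>An open neighbourhood of the closed annulus is required. Going down only to
      half the inner radius keeps away from the accumulation point 0, so that just finitely many
      poles inside the inner circle have to be removed and openness survives.\<close>
    define U where "U = S \<inter> {u. rn n / 2 < norm u} - {p \<in> poles. rn n / 2 < norm p \<and> norm p < rn n}"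
    have "contour_integral (circlepath 0 \<rho>) F = contour_integral (circlepath 0 (rn n)) F
           + 2 * of_real pi * \<i> * (\<Sum>p\<in>h ` A. rs p)"
    proof (rule annulus_residue_sum)
      show "finite (h ` A)" unfolding A_def by (intro finite_imageI finite_SigmaI finK \<open>finite E\<close>)
      have "open (S \<inter> {u. rn n / 2 < norm u})"
        by (intro open_Int \<open>open S\<close> open_Collect_less continuous_intros)
      moreover have "finite {p \<in> poles. rn n / 2 < norm p \<and> norm p < rn n}"
        by (rule finite_subset[OF _ fin_poles[of "rn n / 2"]]) (use rn in auto)
      ultimately show "open U"
        unfolding U_def by (intro open_Diff finite_imp_closed) auto
      show "u \<in> U" if "rn n \<le> norm u" "norm u \<le> \<rho>" for u
        using that rn[of n] S[of u] by (cases "u = 0") (auto simp: U_def)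
      have sub: "U - h ` A \<subseteq> S - poles - {0}"
      proof
        fix u assume u: "u \<in> U - h ` A"
        have "u \<notin> poles"
        proof
          assume "u \<in> poles"
          then obtain e k where ek: "e \<in> E" "u = e * q ^ k" by (auto simp: poles_def)
          with u avoid[OF ek(1), of k n] have "rn n < norm u"
            using \<open>u \<in> poles\<close> by (auto simp: U_def rn_def)
          then have "(e, k) \<in> A" using ek by (auto simp: A_def K_def)
          then have "h (e, k) \<in> h ` A" by blast
          then show False using u ek by (auto simp: h_def)
        qed
        moreover have "u \<in> S" "u \<noteq> 0" using u rn[of n] by (auto simp: U_def)
        ultimately show "u \<in> S - poles - {0}" by blast
      qed
      show "F holomorphic_on U - h ` A"
        unfolding F_def
        by (intro holomorphic_intros holomorphic_on_subset[OF hol])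
           (use sub in \<open>auto simp: poles_def\<close>)
      show "rn n < norm p \<and> norm p < \<rho>" if p: "p \<in> h ` A" for p
      proof -
        obtain e k where ek: "e \<in> E" "k \<in> K n e" "p = e * q ^ k" using p by (auto simp: A_def h_def)
        have "norm p \<le> norm e"
          using powle[of "norm e" k] ek by (auto simp: norm_mult norm_power)
        then show ?thesis using ek E[of e] by (auto simp: K_def)
      qed
      show "((\<lambda>u. (u - p) * F u) \<longlongrightarrow> rs p) (at p)" if p: "p \<in> h ` A" for p
      proof -
        obtain e k where ek: "(e, k) \<in> A" "p = h (e, k)" using p by auto
        show ?thesis
          unfolding ek(2) rs[OF ek(1)] using res[of e k] ek(1) by (auto simp: A_def h_def F_def)
      qed
    qed (use rn in auto)
    also have "(\<Sum>p\<in>h ` A. rs p) = (\<Sum>x\<in>A. rs (h x))" by (rule sum.reindex_cong[OF injh]) auto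
    also have "\<dots> = (\<Sum>(e, k)\<in>A. R e k)" by (rule sum.cong) (auto simp: rs)
    also have "\<dots> = (\<Sum>e\<in>E. \<Sum>k\<in>K n e. R e k)"
      unfolding A_def by (rule sum.Sigma[symmetric]) (use finK \<open>finite E\<close> in auto)
    finally show ?thesis .
  qed
  have cont: "continuous_on (sphere 0 (rn n)) G" for n
  proof (rule holomorphic_on_imp_continuous_on, rule holomorphic_on_subset[OF hol])
    show "sphere 0 (rn n) \<subseteq> S - {e * q ^ k |e k. e \<in> E} - {0}"
    proof
      fix u :: complex assume "u \<in> sphere 0 (rn n)"
      then have u: "norm u = rn n" by simp
      then have "u \<noteq> e * q ^ k" if "e \<in> E" for e k
        using avoid[OF that, of k n] by (auto simp: rn_def)
      moreover have "u \<noteq> 0" using rn[of n] u by auto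
      moreover from this have "u \<in> S" using S[of u] rn[of n] u by auto
      ultimately show "u \<in> S - {e * q ^ k |e k. e \<in> E} - {0}" by auto
    qed
  qed
  have "bounded (G ` sphere 0 (rn 0))"
    by (intro compact_imp_bounded compact_continuous_image cont) auto
  then obtain M where "\<forall>u\<in>sphere 0 (rn 0). norm (G u) \<le> M"
    by (auto simp: bounded_iff)
  then have M: "norm (G u) \<le> M" if "norm u = rn 0" for u
    using that by simp
  have "0 \<le> M" using order_trans[OF norm_ge_zero M[of "of_real (rn 0)"]] rn[of 0] by simp
  \<comment> \<open>Division by \<open>q\<close> carries the circle of radius
    \<open>rn (Suc n)\<close> to that of radius \<open>rn n\<close>, where the induction hypothesis
    applies; all these circles lie within \<open>\<delta>\<close> of 0.\<close>
  have bnd: "norm (G u) \<le> M * \<mu> ^ n" if "norm u = rn n" for u n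
    using that
  proof (induction n arbitrary: u)
    case 0 then show ?case using M by auto
  next
    case (Suc n)
    have nu: "norm (u / q) = rn n" using Suc.prems q0 by (simp add: rn_def norm_divide)
    have "rn n < \<delta>" using r powle[of r n, THEN le_less_trans, of \<delta>] by (auto simp: rn_def)
    then have "norm (G (q * (u / q))) \<le> \<mu> * norm (G (u / q))"
      by (intro \<delta>) (use nu rn[of n] in auto)
    also have "\<dots> \<le> \<mu> * (M * \<mu> ^ n)" by (intro mult_left_mono Suc.IH nu \<mu>)
    finally show ?case using q0 by (simp add: mult_ac)
  qed
  \<comment> \<open>The factor 1 / \<open>u\<close> in \<open>F\<close> exactly compensates the
    shrinking circumference, so the bound on \<open>G\<close> alone decides the limit.\<close>
  have "norm (contour_integral (circlepath 0 (rn n)) F) \<le> M * \<mu> ^ n * (2 * pi)" for n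
  proof -
    have "norm (contour_integral (circlepath 0 (rn n)) F) \<le> (M * \<mu> ^ n / rn n) * (2 * pi * rn n)"
    proof (rule has_contour_integral_bound_circlepath)
      have "F contour_integrable_on circlepath 0 (rn n)"
        unfolding F_def
        by (intro contour_integrable_continuous_circlepath continuous_intros)
           (use cont[of n] rn[of n] in auto)
      then show "(F has_contour_integral contour_integral (circlepath 0 (rn n)) F) (circlepath 0 (rn n))"
        by (rule has_contour_integral_integral)
      show "norm (F x) \<le> M * \<mu> ^ n / rn n" if "norm (x - 0) = rn n" for x
        using bnd[of x n] that rn[of n] by (auto simp: F_def norm_divide divide_right_mono)
    qed (use \<open>0 \<le> M\<close> \<mu> rn[of n] in auto)
    then show ?thesis using rn[of n] by simp
  qed
  moreover have "(\<lambda>n. M * \<mu> ^ n * (2 * pi)) \<longlonglongrightarrow> 0"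
    using \<mu> by (intro tendsto_mult_left_zero tendsto_mult_right_zero LIMSEQ_power_zero) auto
  ultimately have lim0: "(\<lambda>n. contour_integral (circlepath 0 (rn n)) F) \<longlonglongrightarrow> 0"
    by (rule Lim_null_comparison[OF always_eventually[rule_format]])
  \<comment> \<open>Absolute summability gives convergence along the net of finite index sets, and
    the sets \<open>K n e\<close> eventually contain every finite set of indices.\<close>
  have limR: "(\<lambda>n. \<Sum>k\<in>K n e. R e k) \<longlonglongrightarrow> (\<Sum>k. R e k)" if e: "e \<in> E" for e
  proof -
    have "(R e has_sum (\<Sum>k. R e k)) UNIV"
      by (rule norm_summable_imp_has_sum) (use abs_summ[OF e] summable_norm_cancel in blast)+
    then have *: "(sum (R e) \<longlongrightarrow> (\<Sum>k. R e k)) (finite_subsets_at_top UNIV)"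
      by (simp add: has_sum_def)
    have "filterlim (\<lambda>n. K n e) (finite_subsets_at_top UNIV) sequentially"
      unfolding filterlim_finite_subsets_at_top
    proof safe
      fix X :: "nat set" assume "finite X"
      have "\<forall>\<^sub>F n in sequentially. \<forall>k\<in>X. rn n < norm (e * q ^ k)"
        unfolding eventually_ball_finite_distrib[OF \<open>finite X\<close>]
      proof
        fix k
        have "(\<lambda>n. r * norm q ^ n) \<longlonglongrightarrow> 0"
          using q by (intro tendsto_mult_right_zero LIMSEQ_power_zero) auto
        moreover have "0 < norm (e * q ^ k)" using E[OF e] q0 by auto
        ultimately show "\<forall>\<^sub>F n in sequentially. rn n < norm (e * q ^ k)"
          unfolding rn_def by (rule order_tendstoD(2))
      qed
      then show "\<forall>\<^sub>F n in sequentially. finite (K n e) \<and> X \<subseteq> K n e \<and> K n e \<subseteq> UNIV"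
        by eventually_elim (use finK in \<open>auto simp: K_def\<close>)
    qed
    from filterlim_compose[OF * this] show ?thesis .
  qed
  have "(\<lambda>n. contour_integral (circlepath 0 (rn n)) F
           + 2 * of_real pi * \<i> * (\<Sum>e\<in>E. \<Sum>k\<in>K n e. R e k)) \<longlonglongrightarrow>
          0 + 2 * of_real pi * \<i> * (\<Sum>e\<in>E. \<Sum>k. R e k)"
    by (intro tendsto_intros lim0 limR)
  then have ci: "contour_integral (circlepath 0 \<rho>) F = 2 * of_real pi * \<i> * (\<Sum>e\<in>E. \<Sum>k. R e k)"
    unfolding step[symmetric] by (simp add: LIMSEQ_const_iff)
  have "continuous_on (sphere 0 \<rho>) G"
  proof (rule holomorphic_on_imp_continuous_on, rule holomorphic_on_subset[OF hol])
    have "norm (e * q ^ k) < \<rho>" if "e \<in> E" for e k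
    proof -
      have "norm (e * q ^ k) \<le> norm e"
        using powle[of "norm e" k] by (auto simp: norm_mult norm_power)
      then show ?thesis using E[OF that] by linarith
    qed
    then have notpole: "norm u \<noteq> \<rho>" if "u \<in> {e * q ^ k |e k. e \<in> E}" for u
      using that by fastforce
    show "sphere 0 \<rho> \<subseteq> S - {e * q ^ k |e k. e \<in> E} - {0}"
    proof
      fix u :: complex assume "u \<in> sphere 0 \<rho>"
      then have u: "norm u = \<rho>" by simp
      then have "u \<notin> {e * q ^ k |e k. e \<in> E}" using notpole by blast
      moreover have "u \<noteq> 0" using u \<open>0 < \<rho>\<close> by auto
      moreover have "u \<in> S" using S[of u] \<open>u \<noteq> 0\<close> u by simp
      ultimately show "u \<in> S - {e * q ^ k |e k. e \<in> E} - {0}" by blast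
    qed
  qed
  from contour_integral_circle_mean[OF \<open>0 < \<rho>\<close> this] ci
  show "integral {-pi..pi} (\<lambda>\<psi>. G (of_real \<rho> * exp (\<i> * of_real \<psi>)))
           = 2 * of_real pi * (\<Sum>e\<in>E. \<Sum>k. R e k)"
    by (simp add: F_def mult_ac)
qed

section \<open>Shifted factorials and theta functions\<close>

lemma qfin_0 [simp]: "qfin a q 0 = 1"
  by (simp add: qfin_def)

lemma qfin_Suc: "qfin a q (Suc n) = qfin a q n * (1 - a * q ^ n)"
  by (simp add: qfin_def)

lemma qfin_Suc_shift: "qfin a q (Suc n) = (1 - a) * qfin (a * q) q n"
  unfolding qfin_def by (subst prod.lessThan_Suc_shift) (simp add: mult_ac)

lemma qfin_nonzero: "(\<And>n. a * q ^ n \<noteq> 1) \<Longrightarrow> qfin a q n \<noteq> 0"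
  by (auto simp: qfin_def)

lemma summable_qinf: "norm q < 1 \<Longrightarrow> summable (\<lambda>n. norm (1 - a * q ^ n - 1))"
  for q :: complex
  by (simp add: norm_mult norm_power summable_mult summable_geometric)

lemma convergent_prod_qinf: "norm q < 1 \<Longrightarrow> convergent_prod (\<lambda>n. 1 - a * q ^ n)"
  for q :: complex
  by (intro abs_convergent_prod_imp_convergent_prod summable_imp_abs_convergent_prod summable_qinf)

lemma qfin_LIMSEQ: "norm q < 1 \<Longrightarrow> qfin a q \<longlonglongrightarrow> qinf a q"
  using convergent_prod_LIMSEQ[OF convergent_prod_qinf, of q a]
  by (simp add: qfin_def[abs_def] qinf_def LIMSEQ_lessThan_iff_atMost)

lemma qinf_unfold:
  assumes "norm q < 1"
  shows "qinf a q = (1 - a) * qinf (a * q) q"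
proof (rule LIMSEQ_unique)
  show "(\<lambda>n. qfin a q (Suc n)) \<longlonglongrightarrow> qinf a q"
    using qfin_LIMSEQ[OF assms] by (rule LIMSEQ_Suc)
  show "(\<lambda>n. qfin a q (Suc n)) \<longlonglongrightarrow> (1 - a) * qinf (a * q) q"
    unfolding qfin_Suc_shift by (intro tendsto_intros qfin_LIMSEQ assms)
qed

lemma qinf_split: "norm q < 1 \<Longrightarrow> qinf a q = qfin a q n * qinf (a * q ^ n) q"
  by (induction n) (simp_all add: qfin_Suc qinf_unfold[of q "a * q ^ _"] mult_ac)

lemma qinf_nonzero: "norm q < 1 \<Longrightarrow> (\<And>n. a * q ^ n \<noteq> 1) \<Longrightarrow> qinf a q \<noteq> 0"
  unfolding qinf_def by (intro prodinf_nonzero convergent_prod_qinf) auto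

lemma mult_power_neq_1: "norm q < 1 \<Longrightarrow> norm a < 1 \<Longrightarrow> a * q ^ n \<noteq> 1"
  for a q :: complex
proof
  assume *: "norm q < 1" "norm a < 1" "a * q ^ n = 1"
  have "norm (a * q ^ n) \<le> norm a"
    unfolding norm_mult norm_power using * by (intro mult_left_le power_le_one) auto
  with * show False by simp
qed

lemma qinf_nonzero': "norm q < 1 \<Longrightarrow> norm a < 1 \<Longrightarrow> qinf a q \<noteq> 0"
  by (intro qinf_nonzero mult_power_neq_1)

text \<open>The partial products are polynomials in \<open>a\<close>. On the closed unit ball around
  \<open>x\<close> the deviations of the factors from 1 are dominated by
  \<open>(norm x + 1) * norm q ^ n\<close>, so the products converge uniformly and the limit is
  holomorphic.\<close>

lemma holomorphic_qinf:
  assumes q: "norm q < 1"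
  shows "(\<lambda>a. qinf a q) holomorphic_on UNIV"
proof (rule holomorphic_uniform_sequence)
  show "(\<lambda>a. qfin a q n) holomorphic_on UNIV" for n
    unfolding qfin_def by (intro holomorphic_intros)
  fix x :: complex
  have "uniformly_convergent_on (cball x 1) (\<lambda>N a. \<Prod>n<N. 1 - a * q ^ n)"
  proof (rule uniformly_convergent_on_prod')
    show "uniformly_convergent_on (cball x 1) (\<lambda>N a. \<Sum>n<N. norm (1 - a * q ^ n - 1))"
    proof (rule Weierstrass_m_test'[where M = "\<lambda>n. (norm x + 1) * norm q ^ n"])
      fix n and a assume "a \<in> cball x 1"
      then have "norm a \<le> norm x + 1"
        using norm_triangle_ineq3[of a x] by (simp add: dist_norm norm_minus_commute)
      then show "norm (norm (1 - a * q ^ n - 1)) \<le> (norm x + 1) * norm q ^ n"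
        by (simp add: norm_mult norm_power mult_right_mono)
    next
      show "summable (\<lambda>n. (norm x + 1) * norm q ^ n)"
        using q by (simp add: summable_mult summable_geometric)
    qed
  qed (auto intro!: continuous_intros)
  then obtain g where g: "uniform_limit (cball x 1) (\<lambda>N a. qfin a q N) g sequentially"
    by (auto simp: uniformly_convergent_on_def qfin_def)
  also have "?this \<longleftrightarrow> uniform_limit (cball x 1) (\<lambda>N a. qfin a q N) (\<lambda>a. qinf a q) sequentially"
  proof (intro uniform_limit_cong)
    fix a assume "a \<in> cball x 1"
    from tendsto_uniform_limitI[OF g this] show "g a = qinf a q"
      using qfin_LIMSEQ[OF q] LIMSEQ_unique by blast
  qed auto
  finally show "\<exists>d>0. cball x d \<subseteq> UNIV \<and> uniform_limit (cball x d) (\<lambda>N a. qfin a q N) (\<lambda>a. qinf a q) sequentially"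
    by (intro exI[of _ 1]) auto
qed auto

lemma holomorphic_on_qinf [holomorphic_intros]:
  "norm q < 1 \<Longrightarrow> f holomorphic_on S \<Longrightarrow> (\<lambda>x. qinf (f x) q) holomorphic_on S"
  using holomorphic_on_compose_gen[OF _ holomorphic_qinf, of f S q] by (auto simp: o_def)

lemma tendsto_qinf [tendsto_intros]:
  assumes "norm q < 1" "(f \<longlongrightarrow> l) F"
  shows "((\<lambda>x. qinf (f x) q) \<longlongrightarrow> qinf l q) F"
proof -
  have "isCont (\<lambda>a. qinf a q) l"
    using holomorphic_on_imp_continuous_on[OF holomorphic_qinf[OF assms(1)]]
    by (simp add: continuous_on_eq_continuous_at)
  then show ?thesis using assms(2) by (rule isCont_tendsto_compose)
qed

lemma tendsto_qfin [tendsto_intros]: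
  "(f \<longlongrightarrow> l) F \<Longrightarrow> ((\<lambda>x. qfin (f x) q n) \<longlongrightarrow> qfin l q n) F"
  unfolding qfin_def by (intro tendsto_intros)

text \<open>Quasi-periodicity: the first product loses the factor \<open>1 - x\<close>, the second
  gains \<open>1 - 1 / x\<close>, and their quotient is \<open>- (1 / x)\<close>.\<close>

lemma qtheta_mult_q:
  assumes "norm q < 1" "q \<noteq> 0" "x \<noteq> 0"
  shows "qtheta (x * q) q = - (1 / x) * qtheta x q"
proof -
  have "qtheta (x * q) q = qinf (x * q) q * ((1 - 1 / x) * qinf (q / x) q)"
    using assms by (simp add: qtheta_def qinf_unfold[OF assms(1), of "1 / x"])
  also have "\<dots> = - (1 / x) * (((1 - x) * qinf (x * q) q) * qinf (q / x) q)"
    using assms(3) by (simp add: field_simps)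
  also have "(1 - x) * qinf (x * q) q = qinf x q"
    by (rule qinf_unfold[OF assms(1), symmetric])
  finally show ?thesis by (simp add: qtheta_def)
qed

lemma qtheta_mult_q_power:
  assumes "norm q < 1" "q \<noteq> 0" "x \<noteq> 0"
  shows "qtheta (x * q ^ n) q = (-1) ^ n / (x ^ n * q ^ (n choose 2)) * qtheta x q"
proof (induction n)
  case (Suc n)
  have "qtheta (x * q ^ Suc n) q = - (1 / (x * q ^ n)) * qtheta (x * q ^ n) q"
    using qtheta_mult_q[of q "x * q ^ n"] assms by (simp add: mult_ac)
  also have "\<dots> = (-1) ^ Suc n / (x ^ Suc n * q ^ (Suc n choose 2)) * qtheta x q"
    using assms by (simp add: Suc.IH numeral_2_eq_2 power_add field_simps)
  finally show ?case .
qed (auto simp: numeral_2_eq_2)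

text \<open>The quasi-periodicity is run backwards. The exponents 1, ..., \<open>n\<close> of
  \<open>q\<close> add up to \<open>Suc n choose 2\<close>, whereas shifts by positive powers
  collect 0, ..., \<open>n - 1\<close>, which gives \<open>n choose 2\<close>.\<close>

lemma qtheta_divide_q_power:
  assumes "norm q < 1" "q \<noteq> 0" "x \<noteq> 0"
  shows "qtheta (x / q ^ n) q = (- x) ^ n / q ^ (Suc n choose 2) * qtheta x q"
proof (induction n)
  case (Suc n)
  have "qtheta (x / q ^ n) q = - (q ^ Suc n / x) * qtheta (x / q ^ Suc n) q"
    using qtheta_mult_q[of q "x / q ^ Suc n"] assms by simp
  then have "qtheta (x / q ^ Suc n) q = - (x / q ^ Suc n) * qtheta (x / q ^ n) q"
    using assms by (simp add: field_simps)
  also have "\<dots> = (- x) ^ Suc n / q ^ (Suc (Suc n) choose 2) * qtheta x q"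
    using assms by (simp add: Suc.IH numeral_2_eq_2 power_add field_simps)
  finally show ?case .
qed (auto simp: numeral_2_eq_2)

text \<open>The product on the right is \<open>x\<^sup>n (q c / x; q)\<^sub>n\<close>, written so that \<open>x = 0\<close> is allowed.\<close>

lemma qfin_divide_q_power:
  assumes "q \<noteq> 0" "c \<noteq> 0"
  shows "qfin (x / (c * q ^ n)) q n
           = (-1) ^ n / (c ^ n * q ^ (Suc n choose 2)) * (\<Prod>j<n. x - c * q ^ (j + 1))"
proof (induction n)
  case (Suc n)
  have "qfin (x / (c * q ^ Suc n)) q (Suc n) = (1 - x / (c * q ^ Suc n)) * qfin (x / (c * q ^ n)) q n"
    using assms by (simp add: qfin_Suc_shift)
  also have "1 - x / (c * q ^ Suc n) = - (x - c * q ^ (n + 1)) / (c * q ^ Suc n)"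
    using assms by (simp add: field_simps)
  finally show ?case
    using assms by (simp add: Suc.IH numeral_2_eq_2 power_add field_simps)
qed (auto simp: numeral_2_eq_2)

text \<open>Reversing the order of the factors produces the parameter \<open>q / x\<close>, which is
  the form of the denominator parameters in the residue series.\<close>

lemma qfin_divide_q_power':
  assumes "q \<noteq> 0" "x \<noteq> 0"
  shows "qfin (x / q ^ n) q n = (- x) ^ n / q ^ (Suc n choose 2) * qfin (q / x) q n"
proof -
  have "(\<Prod>j<n. x - 1 * q ^ (j + 1)) = x ^ n * qfin (q / x) q n"
    using assms by (induction n) (simp_all add: qfin_Suc field_simps)
  then show ?thesis
    using qfin_divide_q_power[OF assms(1), of 1 x n] by (simp add: power_minus[of x])
qed

section \<open>Holomorphy, limits and algebra of products over lists\<close>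

lemma holomorphic_on_prod_list:
  fixes g :: "'a \<Rightarrow> complex \<Rightarrow> complex"
  shows "(\<And>x. x \<in> set xs \<Longrightarrow> g x holomorphic_on S) \<Longrightarrow> (\<lambda>w. \<Prod>x\<leftarrow>xs. g x w) holomorphic_on S"
  by (induction xs) (auto intro!: holomorphic_intros)

lemma tendsto_prod_list:
  fixes g :: "'a \<Rightarrow> 'b \<Rightarrow> complex"
  shows "(\<And>x. x \<in> set xs \<Longrightarrow> (g x \<longlongrightarrow> l x) F) \<Longrightarrow> ((\<lambda>w. \<Prod>x\<leftarrow>xs. g x w) \<longlongrightarrow> (\<Prod>x\<leftarrow>xs. l x)) F"
  by (induction xs) (auto intro!: tendsto_intros)

lemma prod_list_map_mult: "(\<Prod>x\<leftarrow>xs. g x * h x) = (\<Prod>x\<leftarrow>xs. g x) * (\<Prod>x\<leftarrow>xs. h x)"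
  for g h :: "'a \<Rightarrow> 'b :: comm_monoid_mult"
  by (induction xs) (auto simp: mult_ac)

lemma prod_list_map_divide: "(\<Prod>x\<leftarrow>xs. g x / h x) = (\<Prod>x\<leftarrow>xs. g x) / (\<Prod>x\<leftarrow>xs. h x)"
  for g h :: "'a \<Rightarrow> 'b :: field"
  by (induction xs) auto

lemma prod_list_map_const: "(\<Prod>x\<leftarrow>xs. c) = c ^ length xs"
  for c :: "'b :: comm_monoid_mult"
  by (induction xs) auto

lemma prod_list_map_uminus: "(\<Prod>x\<leftarrow>xs. - x) = (-1) ^ length xs * prod_list xs"
  for xs :: "'b :: comm_ring_1 list"
  by (induction xs) auto

lemma prod_list_map_conv_prod: "(\<Prod>x\<leftarrow>xs. g x) = (\<Prod>i<length xs. g (xs ! i))"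
  for g :: "'a \<Rightarrow> 'b :: comm_monoid_mult"
  by (simp add: prod.list_conv_set_nth atLeast0LessThan)

section \<open>Theta quotients\<close>

text \<open>The list \<open>e\<close> produces the poles accumulating at 0, the list
  \<open>c\<close> those tending to infinity. The integrand arises in two ways: with u = z /
  \<open>\<sigma>\<close>, where \<open>e\<close> is \<open>[d1, d2]\<close> and \<open>b\<close> is
  empty, and with u = \<open>\<sigma>\<close> / z, where the lists of the theorem trade places and
  its \<open>c\<close> plays the part of \<open>e\<close>.\<close>

definition theta_quotient ::
  "complex \<Rightarrow> complex \<Rightarrow> complex list \<Rightarrow> complex list \<Rightarrow> complex list \<Rightarrow> complex list \<Rightarrow> complex \<Rightarrow> complex \<Rightarrow> complex"
  where "theta_quotient \<alpha> \<beta> b e a c q u =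
    qtheta (\<alpha> / u) q * qtheta (\<beta> * u) q * (\<Prod>x\<leftarrow>b. qinf (x / u) q) * (\<Prod>x\<leftarrow>a. qinf (x * u) q)
      / ((\<Prod>x\<leftarrow>e. qinf (x / u) q) * (\<Prod>x\<leftarrow>c. qinf (x * u) q))"

text \<open>The two theta functions contribute \<open>\<alpha> / (\<beta> * q * u^2)\<close>, and
  the lists \<open>b\<close> and \<open>e\<close> contribute \<open>(q * u) ^ (2 + p)\<close>
  besides their linear factors. The negative powers of \<open>u\<close> cancel because
  \<open>e\<close> has at least two more entries than \<open>b\<close>, so the multiplier stays
  regular at 0.\<close>

lemma theta_quotient_mult_q:
  fixes q :: complex
  assumes q: "norm q < 1" "q \<noteq> 0" and nz: "\<alpha> \<noteq> 0" "\<beta> \<noteq> 0" "u \<noteq> 0"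
    and "\<And>x. x \<in> set a \<Longrightarrow> x * u \<noteq> 1" "\<And>x. x \<in> set c \<Longrightarrow> x * u \<noteq> 1"
    and len: "length e = length b + 2 + p"
  shows "theta_quotient \<alpha> \<beta> b e a c q (q * u)
           = \<alpha> / \<beta> * q * (q * u) ^ p * (\<Prod>x\<leftarrow>b. q * u - x) * (\<Prod>x\<leftarrow>c. 1 - x * u)
              / ((\<Prod>x\<leftarrow>e. q * u - x) * (\<Prod>x\<leftarrow>a. 1 - x * u)) * theta_quotient \<alpha> \<beta> b e a c q u"
proof -
  have t1: "qtheta (\<alpha> / (q * u)) q = - (\<alpha> / (q * u)) * qtheta (\<alpha> / u) q"
    using qtheta_mult_q[of q "\<alpha> / (q * u)"] q nz by (simp add: field_simps)
  have t2: "qtheta (\<beta> * (q * u)) q = - (1 / (\<beta> * u)) * qtheta (\<beta> * u) q"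
    using qtheta_mult_q[of q "\<beta> * u"] q nz by (simp add: mult_ac)
  have up: "(\<Prod>x\<leftarrow>xs. qinf (x / (q * u)) q)
      = (\<Prod>x\<leftarrow>xs. q * u - x) / (q * u) ^ length xs * (\<Prod>x\<leftarrow>xs. qinf (x / u) q)" for xs
  proof -
    have "qinf (x / (q * u)) q = (q * u - x) / (q * u) * qinf (x / u) q" for x
      using qinf_unfold[OF q(1), of "x / (q * u)"] q nz by (simp add: diff_divide_distrib)
    then show ?thesis by (simp add: prod_list_map_mult prod_list_map_divide prod_list_map_const power_mult_distrib)
  qed
  have dn: "(\<Prod>x\<leftarrow>xs. qinf (x * (q * u)) q) = (\<Prod>x\<leftarrow>xs. qinf (x * u) q) / (\<Prod>x\<leftarrow>xs. 1 - x * u)"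
    if "\<And>x. x \<in> set xs \<Longrightarrow> x * u \<noteq> 1" for xs
  proof -
    have "qinf (x * (q * u)) q = qinf (x * u) q / (1 - x * u)" if "x * u \<noteq> 1" for x
      using qinf_unfold[OF q(1), of "x * u"] that by (simp add: mult_ac)
    with that have "map (\<lambda>x. qinf (x * (q * u)) q) xs = map (\<lambda>x. qinf (x * u) q / (1 - x * u)) xs"
      by auto
    from arg_cong[OF this, of prod_list] show ?thesis by (simp only: prod_list_map_divide)
  qed
  have dna: "(\<Prod>x\<leftarrow>a. qinf (x * (q * u)) q) = (\<Prod>x\<leftarrow>a. qinf (x * u) q) / (\<Prod>x\<leftarrow>a. 1 - x * u)"
    by (rule dn) (rule assms(6))
  have dnc: "(\<Prod>x\<leftarrow>c. qinf (x * (q * u)) q) = (\<Prod>x\<leftarrow>c. qinf (x * u) q) / (\<Prod>x\<leftarrow>c. 1 - x * u)"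
    by (rule dn) (rule assms(7))
  \<comment> \<open>The identity persists when a denominator vanishes, since division by 0 yields 0;
    the case splits deal with these values before clearing denominators.\<close>
  have alg: "t1 * T1 * (t2 * T2) * (B1 / z ^ k * B) * (A / A1) / ((E1 / z ^ (k + 2 + p) * E) * (C / C1))
      = (t1 * t2 * z ^ 2) * z ^ p * B1 * C1 / (E1 * A1) * (T1 * T2 * B * A / (E * C))"
    if "z \<noteq> 0" for t1 t2 T1 T2 B1 z B A A1 E1 E C C1 :: complex and k
    using that
    by (cases "E = 0"; cases "C = 0"; cases "A1 = 0"; cases "C1 = 0"; cases "E1 = 0";
        simp add: field_simps power2_eq_square power_add)
  have qu: "q * u \<noteq> 0" using q nz by simp
  have zz: "- (\<alpha> / (q * u)) * - (1 / (\<beta> * u)) * (q * u) ^ 2 = \<alpha> / \<beta> * q"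
    using q nz by (simp add: field_simps power2_eq_square)
  show ?thesis
    unfolding theta_quotient_def t1 t2 up dna dnc len
    unfolding alg[OF qu] zz ..
qed

text \<open>The multiplier tends to a limit \<open>L\<close> at 0. For \<open>p > 0\<close> the
  power of \<open>u\<close> makes it 0; for \<open>p = 0\<close> its modulus is the quotient of the
  two sides of \<open>conv\<close>. The midpoint between \<open>norm L\<close> and 1 serves as the
  eventual bound.\<close>

lemma theta_quotient_ratio:
  fixes q :: complex
  assumes q: "norm q < 1" "q \<noteq> 0" and nz: "\<alpha> \<noteq> 0" "\<beta> \<noteq> 0" "\<And>x. x \<in> set e \<Longrightarrow> x \<noteq> 0"
    and len: "length e = length b + 2 + p"
    and conv: "p = 0 \<Longrightarrow> norm (\<alpha> * q * prod_list b) < norm (\<beta> * prod_list e)"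
  shows "\<exists>l<1. \<forall>\<^sub>F u in at 0. norm (theta_quotient \<alpha> \<beta> b e a c q (q * u))
                 \<le> l * norm (theta_quotient \<alpha> \<beta> b e a c q u)"
proof -
  define \<phi> where "\<phi> u = \<alpha> / \<beta> * q * (q * u) ^ p * (\<Prod>x\<leftarrow>b. q * u - x) * (\<Prod>x\<leftarrow>c. 1 - x * u)
              / ((\<Prod>x\<leftarrow>e. q * u - x) * (\<Prod>x\<leftarrow>a. 1 - x * u))" for u
  \<comment> \<open>This is the value of \<open>\<phi>\<close> at 0, left unsimplified so that the
    limit rules match it factor by factor.\<close>
  define L where "L = \<alpha> / \<beta> * q * (q * 0) ^ p * (\<Prod>x\<leftarrow>b. q * 0 - x) * (\<Prod>x\<leftarrow>c. 1 - x * 0)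
              / ((\<Prod>x\<leftarrow>e. q * 0 - x) * (\<Prod>x\<leftarrow>a. 1 - x * 0))"
  have ev: "\<forall>\<^sub>F u in at (0::complex). \<forall>x\<in>set xs. x * u \<noteq> 1" for xs :: "complex list"
  proof (rule eventually_ball_finite, simp, rule ballI)
    fix x :: complex
    have "((\<lambda>u. x * u) \<longlongrightarrow> x * 0) (at 0)" by (rule tendsto_mult[OF tendsto_const tendsto_ident_at])
    then show "\<forall>\<^sub>F u in at (0::complex). x * u \<noteq> 1" by (rule tendsto_imp_eventually_ne) auto
  qed
  have "(\<phi> \<longlongrightarrow> L) (at 0)"
    unfolding \<phi>_def L_def
    by (intro tendsto_intros tendsto_prod_list) (use nz in \<open>auto simp: prod_list_zero_iff\<close>)
  moreover have "norm L < 1"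
  proof (cases "p = 0")
    case True
    have "prod_list e \<noteq> 0" using nz by (auto simp: prod_list_zero_iff)
    then have "norm L = norm (\<alpha> * q * prod_list b) / norm (\<beta> * prod_list e)"
      using True by (simp add: L_def prod_list_map_uminus prod_list_map_const norm_mult norm_divide norm_power)
    also have "\<dots> < 1" using conv[OF True] by (subst divide_less_eq_1_pos) (auto intro: le_less_trans)
    finally show ?thesis .
  qed (simp add: L_def zero_power)
  ultimately have "\<forall>\<^sub>F u in at 0. norm (\<phi> u) < (1 + norm L) / 2"
    by (intro order_tendstoD(2)[of "\<lambda>u. norm (\<phi> u)" "norm L"] tendsto_intros) auto
  moreover have "\<forall>\<^sub>F u in at 0. u \<noteq> (0 :: complex)" by (rule eventually_neq_at_within)
  ultimately have "\<forall>\<^sub>F u in at 0. norm (theta_quotient \<alpha> \<beta> b e a c q (q * u))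
                 \<le> (1 + norm L) / 2 * norm (theta_quotient \<alpha> \<beta> b e a c q u)"
    using ev[of a] ev[of c]
  proof eventually_elim
    case (elim u)
    have "theta_quotient \<alpha> \<beta> b e a c q (q * u) = \<phi> u * theta_quotient \<alpha> \<beta> b e a c q u"
      unfolding \<phi>_def by (rule theta_quotient_mult_q) (use q nz len elim in auto)
    then show ?case
      using elim by (simp only: norm_mult) (intro mult_right_mono, auto)
  qed
  moreover have "(1 + norm L) / 2 < 1" using \<open>norm L < 1\<close> by simp
  ultimately show ?thesis by blast
qed

text \<open>Exactly one factor of the denominator vanishes at \<open>p\<close>, namely the one of
  index \<open>n\<close> in the product for \<open>e ! i\<close>. It equals
  \<open>(u - p) / u\<close>, so cancelling it leaves a function continuous at \<open>p\<close>,
  whose value there is the limit.\<close>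

lemma theta_quotient_residue:
  fixes q :: complex
  assumes q: "norm q < 1" "q \<noteq> 0" and nz: "\<alpha> \<noteq> 0" "\<beta> \<noteq> 0" "\<And>x. x \<in> set e \<Longrightarrow> x \<noteq> 0"
    and i: "i < length e" and p: "p = e ! i * q ^ n"
    and cp: "\<And>x. x \<in> set c \<Longrightarrow> norm (x * p) < 1"
    and sep: "\<And>j m. j < length e \<Longrightarrow> j \<noteq> i \<Longrightarrow> e ! j * q ^ m \<noteq> p"
  shows "((\<lambda>u. (u - p) * (theta_quotient \<alpha> \<beta> b e a c q u / u)) \<longlongrightarrow>
     qtheta (\<alpha> / p) q * qtheta (\<beta> * p) q * (\<Prod>x\<leftarrow>b. qinf (x / p) q) * (\<Prod>x\<leftarrow>a. qinf (x * p) q)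
      / (qfin (1 / q ^ n) q n * qinf q q * (\<Prod>j\<in>{..<length e} - {i}. qinf (e ! j / p) q)
          * (\<Prod>x\<leftarrow>c. qinf (x * p) q))) (at p)"
proof -
  define J where "J = {..<length e} - {i}"
  have ei: "e ! i \<noteq> 0" using nz(3) i by auto
  have p0: "p \<noteq> 0" using ei q p by simp
  \<comment> \<open>The quotient with the vanishing factor cancelled:
    \<open>qfin (e ! i / u) q n\<close> holds the factors before it and
    \<open>qinf (q * (p / u)) q\<close> those after it.\<close>
  define g where "g u = qtheta (\<alpha> / u) q * qtheta (\<beta> * u) q * (\<Prod>x\<leftarrow>b. qinf (x / u) q) * (\<Prod>x\<leftarrow>a. qinf (x * u) q)
      / (qfin (e ! i / u) q n * qinf (q * (p / u)) q * (\<Prod>j\<in>J. qinf (e ! j / u) q)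
          * (\<Prod>x\<leftarrow>c. qinf (x * u) q))" for u
  \<comment> \<open>Read in reverse order this product is \<open>qfin q q n\<close> up to a nonzero
    monomial, and that has no zero factor.\<close>
  have "qfin (1 / q ^ n) q n \<noteq> 0"
    using qfin_divide_q_power'[OF q(2), of 1 n] qfin_nonzero[OF mult_power_neq_1[OF q(1) q(1)]] q(2) by simp
  then have n1: "qfin (e ! i / p) q n \<noteq> 0" using ei by (simp add: p)
  have n2: "qinf (q * (p / p)) q \<noteq> 0" using q p0 by (simp add: qinf_nonzero')
  have n3: "(\<Prod>j\<in>J. qinf (e ! j / p) q) \<noteq> 0"
  proof -
    have "qinf (e ! j / p) q \<noteq> 0" if "j \<in> J" for j
      using that sep[of j] p0 by (intro qinf_nonzero q) (auto simp: J_def field_simps)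
    then show ?thesis by (simp add: J_def)
  qed
  have n4: "(\<Prod>x\<leftarrow>c. qinf (x * p) q) \<noteq> 0"
  proof -
    have "qinf (x * p) q \<noteq> 0" if "x \<in> set c" for x
      by (rule qinf_nonzero'[OF q(1) cp[OF that]])
    then show ?thesis by (auto simp: prod_list_zero_iff)
  qed
  have "(g \<longlongrightarrow> g p) (at p)"
    unfolding g_def qtheta_def
    by (intro tendsto_intros tendsto_prod_list q) (use n1 n2 n3 n4 nz p0 in auto)
  moreover have "\<forall>\<^sub>F u in at p. g u = (u - p) * (theta_quotient \<alpha> \<beta> b e a c q u / u)"
  proof -
    have "\<forall>\<^sub>F u in at p. u \<in> UNIV - {0} - {p}"
      by (rule eventually_at_in_open) (use p0 in auto)
    then show ?thesis
    proof eventually_elim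
      case (elim u)
      have "(\<Prod>x\<leftarrow>e. qinf (x / u) q) = qinf (e ! i / u) q * (\<Prod>j\<in>J. qinf (e ! j / u) q)"
        unfolding prod_list_map_conv_prod J_def using i by (subst prod.remove[of _ i]) auto
      also have "qinf (e ! i / u) q = qfin (e ! i / u) q n * ((1 - p / u) * qinf (q * (p / u)) q)"
        by (subst qinf_split[OF q(1), of _ n], subst qinf_unfold[OF q(1)]) (simp add: p mult_ac)
      also have "1 - p / u = (u - p) / u" using elim by (simp add: field_simps)
      finally have den: "(\<Prod>x\<leftarrow>e. qinf (x / u) q)
          = qfin (e ! i / u) q n * ((u - p) / u * qinf (q * (p / u)) q) * (\<Prod>j\<in>J. qinf (e ! j / u) q)" .
      have alg: "v * (X / (F * (v / u * Q) * Y * C) / u) = X / (F * Q * Y * C)"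
        if "v \<noteq> 0" for v X F Q Y C :: complex
        using that elim by (cases "F = 0"; cases "Q = 0"; cases "Y = 0"; cases "C = 0"; simp add: field_simps)
      show ?case
        unfolding g_def theta_quotient_def den by (rule alg[symmetric]) (use elim in simp)
    qed
  qed
  ultimately have "((\<lambda>u. (u - p) * (theta_quotient \<alpha> \<beta> b e a c q u / u)) \<longlongrightarrow> g p) (at p)"
    by (rule Lim_transform_eventually)
  then show ?thesis
    using p0 ei q(2) by (simp add: g_def p J_def)
qed

text \<open>Closed form of the residue of \<open>theta_quotient \<alpha> \<beta> b e a c q u / u\<close> at \<open>u = e ! i * q ^ n\<close>.\<close>

definition theta_quotient_term ::
  "complex \<Rightarrow> complex \<Rightarrow> complex list \<Rightarrow> complex list \<Rightarrow> complex list \<Rightarrow> complex list \<Rightarrow> complex \<Rightarrow> nat \<Rightarrow> nat \<Rightarrow> complex"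
  where "theta_quotient_term \<alpha> \<beta> b e a c q i n =
    (let x = e ! i; J = {..<length e} - {i}; p = length e - length b - 2 in
      qtheta (\<alpha> / x) q * qtheta (\<beta> * x) q * (\<Prod>y\<leftarrow>b. qinf (y / x) q)
        / (qinf q q * (\<Prod>j\<in>J. qinf (e ! j / x) q))
      * ((\<Prod>y\<leftarrow>a. qinf (y * (x * q ^ n)) q) * (\<Prod>y\<leftarrow>b. \<Prod>j<n. y - x * q ^ (j + 1))
          / (qfin q q n * (\<Prod>j\<in>J. qfin (q * x / e ! j) q n) * (\<Prod>y\<leftarrow>c. qinf (y * (x * q ^ n)) q))
        * ((-1) ^ n * q ^ (n choose 2)) ^ p * (\<alpha> / \<beta> * q * (q * x) ^ p / prod_list e) ^ n))"

text \<open>Every factor is shifted from \<open>p\<close> back to \<open>e ! i\<close>, at the price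
  of signs and powers of \<open>q\<close> and \<open>e ! i\<close>. The denominator has one factor
  fewer than \<open>length e\<close> from the other poles and one from
  \<open>qfin (1 / q ^ n) q n\<close>; balanced against the two thetas and the list
  \<open>b\<close>, this leaves the excess \<open>length e - length b - 2\<close> as the exponent of
  \<open>(-1) ^ n * q ^ (n choose 2)\<close>.\<close>

lemma theta_quotient_residue_closed_form:
  fixes q :: complex
  assumes q: "norm q < 1" "q \<noteq> 0" and nz: "\<alpha> \<noteq> 0" "\<beta> \<noteq> 0" "\<And>x. x \<in> set e \<Longrightarrow> x \<noteq> 0"
    and i: "i < length e" and p: "p = e ! i * q ^ n" and len: "length e \<ge> length b + 2"
  shows "qtheta (\<alpha> / p) q * qtheta (\<beta> * p) q * (\<Prod>x\<leftarrow>b. qinf (x / p) q) * (\<Prod>x\<leftarrow>a. qinf (x * p) q)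
      / (qfin (1 / q ^ n) q n * qinf q q * (\<Prod>j\<in>{..<length e} - {i}. qinf (e ! j / p) q)
          * (\<Prod>x\<leftarrow>c. qinf (x * p) q)) = theta_quotient_term \<alpha> \<beta> b e a c q i n"
proof -
  define x where "x = e ! i"
  define J where "J = {..<length e} - {i}"
  define k where "k = length e - length b - 2"
  \<comment> \<open>With these abbreviations \<open>q ^ (Suc n choose 2)\<close> becomes
    \<open>s * t\<close>, and the collected prefactors obey an identity between monomials in which
    signs cancel through \<open>m * m = 1\<close>.\<close>
  define m where "m = (-1 :: complex) ^ n"
  define s where "s = q ^ n"
  define t where "t = q ^ (n choose 2)"
  have ej: "e ! j \<noteq> 0" if "j < length e" for j using nz(3) that by auto
  have x0: "x \<noteq> 0" using ej i by (simp add: x_def)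
  have mm: "m * m = 1" "m \<noteq> 0" by (simp_all add: m_def power_mult_distrib[symmetric])
  have st0: "s \<noteq> 0" "t \<noteq> 0" using q by (auto simp: s_def t_def)
  have p': "p = x * s" by (simp add: p x_def s_def)
  have Suc_choose: "q ^ (Suc n choose 2) = s * t"
    by (simp add: s_def t_def numeral_2_eq_2 power_add)
  have minus_pow: "(- y) ^ n = m * y ^ n" for y
    unfolding m_def by (rule power_minus)
  have cJ: "card J = length b + 1 + k"
    using i len by (simp add: J_def k_def)
  have h1: "qtheta (\<alpha> / p) q = m * (\<alpha> ^ n / x ^ n) / (s * t) * qtheta (\<alpha> / x) q"
    using qtheta_divide_q_power[OF q, of "\<alpha> / x" n] nz x0
    by (simp only: p' minus_pow Suc_choose s_def[symmetric] divide_divide_eq_left power_divide) simp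
  have h2: "qtheta (\<beta> * p) q = m / (\<beta> ^ n * x ^ n * t) * qtheta (\<beta> * x) q"
    using qtheta_mult_q_power[OF q, of "\<beta> * x" n] nz x0
    by (simp add: p' s_def t_def m_def power_mult_distrib mult.assoc)
  have shift: "qinf (y / p) q = qfin (y / p) q n * qinf (y / x) q" for y
    using qinf_split[OF q(1), of "y / p" n] q by (simp add: p' s_def)
  have h3: "(\<Prod>y\<leftarrow>b. qinf (y / p) q)
      = (m / (x ^ n * (s * t))) ^ length b * (\<Prod>y\<leftarrow>b. \<Prod>j<n. y - x * q ^ (j + 1)) * (\<Prod>y\<leftarrow>b. qinf (y / x) q)"
  proof -
    have "qfin (y / p) q n = m / (x ^ n * (s * t)) * (\<Prod>j<n. y - x * q ^ (j + 1))" for y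
      using qfin_divide_q_power[OF q(2) x0, of y n] by (simp only: p' s_def m_def Suc_choose)
    then show ?thesis
      by (simp only: shift prod_list_map_mult prod_list_map_const)
  qed
  have h4: "qfin (1 / q ^ n) q n = m / (s * t) * qfin q q n"
    using qfin_divide_q_power'[OF q(2), of 1 n] by (simp add: m_def Suc_choose)
  have h5: "(\<Prod>j\<in>J. qinf (e ! j / p) q)
      = m ^ (length b + 1 + k) * (prod_list e ^ n / x ^ n / (x ^ n) ^ (length b + 1 + k)) / (s * t) ^ (length b + 1 + k)
        * (\<Prod>j\<in>J. qfin (q * x / e ! j) q n) * (\<Prod>j\<in>J. qinf (e ! j / x) q)"
  proof -
    have "qfin (e ! j / p) q n = m * (e ! j ^ n / x ^ n) / (s * t) * qfin (q * x / e ! j) q n" if "j \<in> J" for j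
      using qfin_divide_q_power'[OF q(2), of "e ! j / x" n] x0 ej[of j] that
      by (simp add: p' J_def minus_pow Suc_choose s_def[symmetric] power_divide)
    then have "(\<Prod>j\<in>J. qinf (e ! j / p) q)
        = (\<Prod>j\<in>J. m * (e ! j ^ n / x ^ n) / (s * t) * qfin (q * x / e ! j) q n * qinf (e ! j / x) q)"
      by (intro prod.cong) (auto simp: shift)
    also have "\<dots> = m ^ card J * ((\<Prod>j\<in>J. e ! j) ^ n / (x ^ n) ^ card J) / (s * t) ^ card J
         * (\<Prod>j\<in>J. qfin (q * x / e ! j) q n) * (\<Prod>j\<in>J. qinf (e ! j / x) q)"
      by (simp add: prod.distrib prod_dividef prod_power_distrib power_mult_distrib)
    also have "prod_list e = x * (\<Prod>j\<in>J. e ! j)"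
      using prod_list_map_conv_prod[of "\<lambda>x. x" e] i
      by (simp add: J_def x_def prod.remove[of "{..<length e}" i])
    then have "(\<Prod>j\<in>J. e ! j) = prod_list e / x" using x0 by simp
    finally show ?thesis by (simp only: cJ power_divide)
  qed
  have alg: "(m * (A / X) / (s * t)) * Th1 * (m / (B * X * t) * Th2) * ((m / (X * (s * t))) ^ l * R * R') * S
      / (m / (s * t) * Q * Qi * (m ^ (l + 1 + k) * (P / X / X ^ (l + 1 + k)) / (s * t) ^ (l + 1 + k) * U * V) * W)
    = Th1 * Th2 * R' / (Qi * V) * (S * R / (Q * U * W) * (m * t) ^ k * (A / B * s * (s * X) ^ k / P))"
    if "X \<noteq> 0" "B \<noteq> 0" "P \<noteq> 0" for A X B Th1 Th2 R R' S Q Qi P U V W :: complex and l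
  proof -
    have mk: "m ^ k * m ^ k = 1" by (simp add: mm power_mult_distrib[symmetric])
    have "(m * (A / X) / (s * t)) * (m / (B * X * t)) * (m / (X * (s * t))) ^ l
      / (m / (s * t) * (m ^ (l + 1 + k) * (P / X / X ^ (l + 1 + k)) / (s * t) ^ (l + 1 + k)))
      = (A * s * (s * X) ^ k * t ^ k / (B * P)) / m ^ k"
      using that mm st0 by (simp add: power_add power_mult_distrib power_divide field_simps)
    also have "\<dots> = (m * t) ^ k * (A / B * s * (s * X) ^ k / P)"
      using that mm mk by (simp add: power_mult_distrib field_simps)
    finally have 1: "(m * (A / X) / (s * t)) * (m / (B * X * t)) * (m / (X * (s * t))) ^ l
      / (m / (s * t) * (m ^ (l + 1 + k) * (P / X / X ^ (l + 1 + k)) / (s * t) ^ (l + 1 + k)))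
      = (m * t) ^ k * (A / B * s * (s * X) ^ k / P)" .
    have 2: "c1 * Th1 * (c2 * Th2) * (c3 * R * R') * S / (c4 * Q * Qi * (c5 * U * V) * W)
       = Th1 * Th2 * R' / (Qi * V) * (S * R / (Q * U * W) * (c1 * c2 * c3 / (c4 * c5)))" for c1 c2 c3 c4 c5
      by (simp add: mult_ac)
    show ?thesis by (subst 2, subst 1) (simp add: mult.assoc)
  qed
  have "prod_list e \<noteq> 0" using nz by (auto simp: prod_list_zero_iff)
  then show ?thesis
    unfolding J_def[symmetric] h1 h2 h3 h4 h5 theta_quotient_term_def Let_def x_def[symmetric] k_def[symmetric]
    by (subst alg)
       (use x0 nz in \<open>simp_all add: p' s_def[symmetric] m_def[symmetric] t_def[symmetric]
          power_mult_distrib power_divide power_mult[symmetric] mult.commute[of n]\<close>,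
        simp add: s_def power_mult[symmetric] mult.commute[of n])
qed

text \<open>\<open>Omega_q\<close> contains only powers of \<open>q\<close> with nonpositive
  exponent, so which of the two quotients would fall into it depends on which exponent is
  larger.\<close>

lemma not_Omega_q_imp_powers_neq:
  assumes "q \<noteq> 0" "x \<noteq> 0" "y \<noteq> 0" "x / y \<notin> Omega_q q" "y / x \<notin> Omega_q q"
  shows "x * q ^ k \<noteq> y * q ^ l"
proof
  assume eq: "x * q ^ k = y * q ^ l"
  have "x / y = inverse q ^ (k - l) \<or> y / x = inverse q ^ (l - k)"
  proof (cases "l \<le> k")
    case True
    then have "q ^ k = q ^ (k - l) * q ^ l" by (simp flip: power_add)
    with eq assms have "x * q ^ (k - l) = y" by simp
    then show ?thesis using assms by (auto simp: power_inverse field_simps)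
  next
    case False
    then have "q ^ l = q ^ (l - k) * q ^ k" by (simp flip: power_add)
    with eq assms have "x = y * q ^ (l - k)" by simp
    then show ?thesis using assms by (auto simp: power_inverse field_simps)
  qed
  then show False using assms(4,5) by (auto simp: Omega_q_def)
qed

text \<open>The circle of radius \<open>\<rho>\<close> separates the two families of poles: those
  from \<open>e\<close> lie inside, those from \<open>c\<close> outside. The general residue series
  then applies, with \<open>sep\<close> keeping all the inner poles simple and distinct.\<close>

lemma theta_quotient_integral:
  fixes q \<alpha> \<beta> :: complex
  assumes q: "0 < norm q" "norm q < 1" and nz: "\<alpha> \<noteq> 0" "\<beta> \<noteq> 0" and "0 < \<rho>"
    and e: "\<And>x. x \<in> set e \<Longrightarrow> x \<noteq> 0 \<and> norm x < \<rho>"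
    and c: "\<And>x. x \<in> set c \<Longrightarrow> norm x * \<rho> < 1"
    and sep: "\<And>i j. i < length e \<Longrightarrow> j < length e \<Longrightarrow> i \<noteq> j \<Longrightarrow> e ! i / e ! j \<notin> Omega_q q"
    and len: "length e \<ge> length b + 2"
    and conv: "length e = length b + 2 \<Longrightarrow> norm (\<alpha> * q * prod_list b) < norm (\<beta> * prod_list e)"
  shows "i < length e \<Longrightarrow> summable (theta_quotient_term \<alpha> \<beta> b e a c q i)"
    and "integral {-pi..pi} (\<lambda>\<psi>. theta_quotient \<alpha> \<beta> b e a c q (of_real \<rho> * exp (\<i> * of_real \<psi>)))
           = 2 * of_real pi * (\<Sum>i<length e. \<Sum>n. theta_quotient_term \<alpha> \<beta> b e a c q i n)"
proof -
  have q0: "q \<noteq> 0" using q by auto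
  obtain p where p: "length e = length b + 2 + p" using len le_Suc_ex by blast
  have pow: "e ! i * q ^ k \<noteq> e ! j * q ^ l" if "i < length e" "j < length e" "i \<noteq> j" for i j k l
    by (rule not_Omega_q_imp_powers_neq) (use that sep q0 e nth_mem in blast)+
  have inj: "inj_on ((!) e) {..<length e}"
    using pow[where k = 0 and l = 0] by (auto simp: inj_on_def)
  have img: "set e = (!) e ` {..<length e}"
    by (auto simp: set_conv_nth)
  \<comment> \<open>Residues were indexed by the points of \<open>set e\<close>, the closed-form
    terms by positions in the list; the entries are distinct, so positions can be recovered.\<close>
  define idx where "idx = inv_into {..<length e} ((!) e)"
  have idx: "idx (e ! i) = i" if "i < length e" for i
    unfolding idx_def using inv_into_f_f[OF inj] that by simp
  \<comment> \<open>On this open neighbourhood of the closed disc no factor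
    \<open>qinf (x * u) q\<close> coming from \<open>c\<close> vanishes.\<close>
  define S where "S = {u. \<forall>x\<in>set c. norm (x * u) < 1}"
  have S_eq: "S = (\<Inter>x\<in>set c. {u. norm (x * u) < 1})" by (auto simp: S_def)
  have "open S"
    unfolding S_eq by (intro open_INT open_Collect_less continuous_intros ballI) auto
  have S: "u \<in> S" if "norm u \<le> \<rho>" for u
  proof -
    have "norm (x * u) < 1" if "x \<in> set c" for x
      using mult_left_mono[OF \<open>norm u \<le> \<rho>\<close>, of "norm x"] c[OF that] by (simp add: norm_mult)
    then show ?thesis by (auto simp: S_def)
  qed
  have powne: "q ^ k \<noteq> q ^ l" if "k < l" for k l
    using power_strict_decreasing[OF that q] by (metis norm_power less_irrefl)
  have poles_inj: "x = y \<and> k = l" if xy: "x \<in> set e" "y \<in> set e" "x * q ^ k = y * q ^ l" for x y k l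
  proof -
    obtain i j where ij: "i < length e" "j < length e" "x = e ! i" "y = e ! j"
      using xy by (auto simp: in_set_conv_nth)
    then have "i = j" using pow[of i j k l] xy by auto
    then have "x = y" "q ^ k = q ^ l" using ij xy e[of x] by auto
    then show ?thesis using powne[of k l] powne[of l k] by (metis linorder_neqE_nat)
  qed
  obtain l where l: "l < 1" "\<forall>\<^sub>F u in at 0. norm (theta_quotient \<alpha> \<beta> b e a c q (q * u))
                 \<le> l * norm (theta_quotient \<alpha> \<beta> b e a c q u)"
    using theta_quotient_ratio[OF q(2) q0 nz _ p, of a c] conv e p by auto
  have hol: "theta_quotient \<alpha> \<beta> b e a c q holomorphic_on S - {x * q ^ k |x k. x \<in> set e} - {0}"
  proof -
    have 1: "(\<Prod>x\<leftarrow>e. qinf (x / u) q) \<noteq> 0" if u: "u \<in> S - {x * q ^ k |x k. x \<in> set e} - {0}" for u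
    proof -
      have "qinf (x / u) q \<noteq> 0" if "x \<in> set e" for x
        by (rule qinf_nonzero[OF q(2)]) (use u that in \<open>auto simp: field_simps\<close>)
      then show ?thesis by (auto simp: prod_list_zero_iff)
    qed
    have 2: "(\<Prod>x\<leftarrow>c. qinf (x * u) q) \<noteq> 0" if u: "u \<in> S" for u
    proof -
      have "qinf (x * u) q \<noteq> 0" if "x \<in> set c" for x
        by (rule qinf_nonzero'[OF q(2)]) (use u that in \<open>auto simp: S_def\<close>)
      then show ?thesis by (auto simp: prod_list_zero_iff)
    qed
    show ?thesis
      unfolding theta_quotient_def qtheta_def
      by (intro holomorphic_intros holomorphic_on_prod_list q) (use 1 2 nz in auto)
  qed
  have res: "((\<lambda>u. (u - x * q ^ n) * (theta_quotient \<alpha> \<beta> b e a c q u / u))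
       \<longlongrightarrow> theta_quotient_term \<alpha> \<beta> b e a c q (idx x) n) (at (x * q ^ n))" if x: "x \<in> set e" for x n
  proof -
    obtain i where i: "i < length e" "x = e ! i" using x by (auto simp: in_set_conv_nth)
    have "norm (x * q ^ n) \<le> norm x"
      unfolding norm_mult norm_power using q by (intro mult_left_le power_le_one) auto
    then have "x * q ^ n \<in> S" using e[OF x] by (intro S) simp
    then have cp: "norm (y * (x * q ^ n)) < 1" if "y \<in> set c" for y
      using that by (auto simp: S_def)
    have 1: "theta_quotient_term \<alpha> \<beta> b e a c q i n =
     qtheta (\<alpha> / (x * q ^ n)) q * qtheta (\<beta> * (x * q ^ n)) q * (\<Prod>y\<leftarrow>b. qinf (y / (x * q ^ n)) q)
      * (\<Prod>y\<leftarrow>a. qinf (y * (x * q ^ n)) q)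
      / (qfin (1 / q ^ n) q n * qinf q q * (\<Prod>j\<in>{..<length e} - {i}. qinf (e ! j / (x * q ^ n)) q)
          * (\<Prod>y\<leftarrow>c. qinf (y * (x * q ^ n)) q))"
      by (rule theta_quotient_residue_closed_form[symmetric]) (use q q0 nz i len e in auto)
    have "idx x = i" using i idx by simp
    show ?thesis
      unfolding \<open>idx x = i\<close> 1
      by (rule theta_quotient_residue) (use q q0 nz i e cp pow in auto)
  qed
  note facts = q finite_set \<open>0 < \<rho>\<close> e poles_inj \<open>open S\<close> S hol res l
  have main1: "summable (theta_quotient_term \<alpha> \<beta> b e a c q (idx x))" if "x \<in> set e" for x
    by (rule circle_mean_eq_residue_series(1)[where E = "set e" and S = S and G = "theta_quotient \<alpha> \<beta> b e a c q"
          and R = "\<lambda>x. theta_quotient_term \<alpha> \<beta> b e a c q (idx x)"]; (assumption | rule facts that)+)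
  have main2: "integral {-pi..pi} (\<lambda>\<psi>. theta_quotient \<alpha> \<beta> b e a c q (of_real \<rho> * exp (\<i> * of_real \<psi>)))
           = 2 * of_real pi * (\<Sum>x\<in>set e. \<Sum>n. theta_quotient_term \<alpha> \<beta> b e a c q (idx x) n)"
    by (rule circle_mean_eq_residue_series(2)[where S = S]; (assumption | rule facts)+)
  show "i < length e \<Longrightarrow> summable (theta_quotient_term \<alpha> \<beta> b e a c q i)"
    using main1[of "e ! i"] by (simp add: idx)
  show "integral {-pi..pi} (\<lambda>\<psi>. theta_quotient \<alpha> \<beta> b e a c q (of_real \<rho> * exp (\<i> * of_real \<psi>)))
           = 2 * of_real pi * (\<Sum>i<length e. \<Sum>n. theta_quotient_term \<alpha> \<beta> b e a c q i n)"
    using main2 unfolding img sum.reindex[OF inj] by (simp add: idx)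
qed

section \<open>From residue series to the functions \<open>Hfun\<close> and
  \<open>Jfun\<close>\<close>

lemma suminf_mult_const:
  fixes k :: "'a :: real_normed_field"
  assumes "summable (\<lambda>n. k * g n)"
  shows "(\<Sum>n. k * g n) = k * (\<Sum>n. g n)"
  \<comment> \<open>For \<open>k = 0\<close> both sides are 0 whatever the value of the series of
    \<open>g\<close>; otherwise summability passes from the scaled series to
    \<open>g\<close>.\<close>
  using assms by (cases "k = 0") (auto simp: summable_cmult_iff suminf_mult)

lemma qinf_shift_eq:
  assumes "norm q < 1" "norm y < 1"
  shows "qinf (y * q ^ n) q = qinf y q / qfin y q n"
  using qinf_split[OF assms(1), of y n] qfin_nonzero[OF mult_power_neq_1[OF assms]] by simp

text \<open>The bound on \<open>x * y\<close> excludes zeros of the finite products, so these can be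
  divided out. Standing in the denominator of a residue, they become numerator parameters of the
  series.\<close>

lemma prod_list_qinf_shift:
  assumes "norm q < 1" "\<And>y. y \<in> set ys \<Longrightarrow> norm (x * y) < 1"
  shows "(\<Prod>y\<leftarrow>ys. qinf (y * (x * q ^ n)) q) = (\<Prod>y\<leftarrow>ys. qinf (x * y) q) / (\<Prod>y\<leftarrow>ys. qfin (x * y) q n)"
proof -
  have "qinf (y * (x * q ^ n)) q = qinf (x * y) q / qfin (x * y) q n" if "y \<in> set ys" for y
    using qinf_shift_eq[OF assms(1) assms(2)[OF that], of n] by (simp add: mult_ac)
  then have "map (\<lambda>y. qinf (y * (x * q ^ n)) q) ys = map (\<lambda>y. qinf (x * y) q / qfin (x * y) q n) ys"
    by simp
  from arg_cong[OF this, of prod_list] show ?thesis by (simp only: prod_list_map_divide)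
qed

text \<open>At \<open>d1\<close> the two theta arguments are \<open>f\<close> and
  \<open>f * d1 / d2\<close>, at \<open>d2\<close> the same two in the opposite order. This is why a
  common theta factor can be taken out and the remainder is symmetrised in \<open>d1\<close> and
  \<open>d2\<close>; the parameters also combine to the argument \<open>q\<close>.\<close>

lemma theta_quotient_term_pair:
  assumes q: "norm q < 1" and f: "f \<noteq> 0" and d: "d1 \<noteq> 0" "d2 \<noteq> 0"
    and e: "e = [d1, d2]" and i: "i < 2" "x = e ! i" "x' = e ! (1 - i)"
    and c: "\<And>y. y \<in> set c \<Longrightarrow> norm (x * y) < 1"
  shows "theta_quotient_term (f * d1) (f / d2) [] e a c q i n
    = qtheta f q * qtheta (f * d1 / d2) q / (qinf q q * (qinf (x' / x) q * (\<Prod>y\<leftarrow>c. qinf (x * y) q)))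
      * ((\<Prod>y\<leftarrow>a. qinf (x * y * q ^ n) q) * (\<Prod>y\<leftarrow>c. qfin (x * y) q n)
            / (qfin q q n * qfin (q * x / x') q n) * q ^ n)"
proof -
  have i01: "i = 0 \<or> i = 1" using i(1) by auto
  have th: "qtheta (f * d1 / x) q * qtheta (f / d2 * x) q = qtheta f q * qtheta (f * d1 / d2) q"
    using i01 i(2) e d by (elim disjE) (simp_all add: mult_ac)
  have J: "{..<length e} - {i} = {1 - i}" using i01 by (elim disjE) (auto simp: e)
  have base: "f * d1 / (f / d2) * q * (q * x) ^ (length e - length ([] :: complex list) - 2) / prod_list e = q"
    using f d by (simp add: e)
  have len: "length e = 2" by (simp add: e)
  have cs: "(\<Prod>y\<leftarrow>c. qinf (y * (x * q ^ n)) q) = (\<Prod>y\<leftarrow>c. qinf (x * y) q) / (\<Prod>y\<leftarrow>c. qfin (x * y) q n)"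
    by (rule prod_list_qinf_shift[OF q]) (rule c)
  have a: "(\<Prod>y\<leftarrow>a. qinf (y * (x * q ^ n)) q) = (\<Prod>y\<leftarrow>a. qinf (x * y * q ^ n) q)"
    by (simp add: mult_ac)
  show ?thesis
    unfolding theta_quotient_term_def Let_def i(2)[symmetric] base J th a cs
    by (simp add: i(3)[symmetric, simplified] len mult_ac)
qed

theorem theorem2p2:
  fixes q f d1 d2 :: complex and a c :: "complex list" and \<sigma> :: real
  assumes q: "0 < norm q" "norm q < 1"
    and AC: "a \<noteq> [] \<or> c \<noteq> []"
    and d: "d1 \<noteq> 0" "d2 \<noteq> 0"
    and sig: "\<sigma> > 0"
    and f: "f \<noteq> 0"
    and cbound: "\<forall>x\<in>set c. norm x < \<sigma>"
    and dbound: "norm d1 < 1 / \<sigma>" "norm d2 < 1 / \<sigma>"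
    and cd: "\<forall>x\<in>set c. x * d1 \<notin> Omega_q q \<and> x * d2 \<notin> Omega_q q"
    and dd: "d1 / d2 \<notin> Omega_q q" "d2 / d1 \<notin> Omega_q q"
    and fq: "f \<notin> qZ q" "f * d1 / d2 \<notin> qZ q"
  shows "integral {-pi..pi} (integrand a c d1 d2 \<sigma> f q)
           = 2 * pi * qtheta f q * qtheta (f * d1 / d2) q / qinf q q * Hfun a c d1 d2 q
       \<and> ((length c \<ge> length a + 2
            \<and> (\<forall>x\<in>set c. x \<noteq> 0)
            \<and> (\<forall>k<length c. \<forall>k'<length c. k \<noteq> k' \<longrightarrow> c ! k / c ! k' \<notin> Omega_q q)
            \<and> (length c = length a + 2 \<longrightarrow>
                 norm (q * prod_list a) < norm (d1 * d2 * prod_list c)))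
          \<longrightarrow> integral {-pi..pi} (integrand a c d1 d2 \<sigma> f q)
                = 2 * pi / qinf q q * Jfun a c d1 d2 f q)"
proof (intro conjI impI)
  have dc: "norm (d1 * x) < 1 \<and> norm (d2 * x) < 1" if "x \<in> set c" for x
  proof -
    have "norm y * norm x < 1" if "norm y < 1 / \<sigma>" for y :: complex
    proof -
      have "norm y * norm x \<le> norm y * \<sigma>"
        using cbound \<open>x \<in> set c\<close> by (intro mult_left_mono) auto
      also have "\<dots> < 1" using that sig by (simp add: field_simps)
      finally show ?thesis .
    qed
    then show ?thesis using dbound by (simp add: norm_mult)
  qed
  let ?K = "qtheta f q * qtheta (f * d1 / d2) q"
  define T where "T = theta_quotient_term (f * d1) (f / d2) [] [d1, d2] a c q"
  define t where "t x x' n = (\<Prod>y\<leftarrow>a. qinf (x * y * q ^ n) q) * (\<Prod>y\<leftarrow>c. qfin (x * y) q n)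
            / (qfin q q n * qfin (q * x / x') q n) * q ^ n" for x x' n
  define k where "k x x' = ?K / (qinf q q * (qinf (x' / x) q * (\<Prod>y\<leftarrow>c. qinf (x * y) q)))" for x x'
  have T0: "T 0 = (\<lambda>n. k d1 d2 * t d1 d2 n)"
    unfolding T_def t_def k_def by (rule ext, rule theta_quotient_term_pair) (use q f d dc in auto)
  have T1: "T 1 = (\<lambda>n. k d2 d1 * t d2 d1 n)"
    unfolding T_def t_def k_def by (rule ext, rule theta_quotient_term_pair) (use q f d dc in auto)
  \<comment> \<open>Here \<open>e\<close> exceeds \<open>b\<close> by exactly two entries, so the
    convergence condition is in force; it reduces to \<open>norm q < 1\<close>, because
    \<open>f / d2 * (d1 * d2) = f * d1\<close>.\<close>
  have summ: "summable (T i)" if "i < 2" for i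
    unfolding T_def
    by (rule theta_quotient_integral(1)[where \<rho> = "1 / \<sigma>"])
       (use q f d dbound sig cbound dd that in \<open>auto simp: norm_mult norm_divide less_Suc_eq numeral_2_eq_2\<close>)
  have "integral {-pi..pi} (\<lambda>\<psi>. theta_quotient (f * d1) (f / d2) [] [d1, d2] a c q (of_real (1 / \<sigma>) * exp (\<i> * of_real \<psi>)))
      = 2 * of_real pi * (\<Sum>i<length [d1, d2]. \<Sum>n. T i n)"
    unfolding T_def
    by (rule theta_quotient_integral(2))
       (use q f d dbound sig cbound dd in \<open>auto simp: norm_mult norm_divide less_Suc_eq numeral_2_eq_2\<close>)
  also have "(\<lambda>\<psi>. theta_quotient (f * d1) (f / d2) [] [d1, d2] a c q (of_real (1 / \<sigma>) * exp (\<i> * of_real \<psi>)))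
      = integrand a c d1 d2 \<sigma> f q"
    using f d sig by (intro ext) (simp add: integrand_def theta_quotient_def qtheta_def Let_def mult_ac)
  also have "(\<Sum>i<length [d1, d2]. \<Sum>n. T i n) = k d1 d2 * (\<Sum>n. t d1 d2 n) + k d2 d1 * (\<Sum>n. t d2 d1 n)"
    using summ[of 0] summ[of 1] by (simp add: lessThan_Suc T0 T1[simplified] suminf_mult_const)
  also have "\<dots> = ?K / qinf q q * Hfun a c d1 d2 q"
    by (simp add: Hfun_def Hhalf_def t_def k_def distrib_left)
  finally show "integral {-pi..pi} (integrand a c d1 d2 \<sigma> f q)
           = 2 * pi * qtheta f q * qtheta (f * d1 / d2) q / qinf q q * Hfun a c d1 d2 q"
    by simp
next
  assume A: "length c \<ge> length a + 2
            \<and> (\<forall>x\<in>set c. x \<noteq> 0)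
            \<and> (\<forall>k<length c. \<forall>k'<length c. k \<noteq> k' \<longrightarrow> c ! k / c ! k' \<notin> Omega_q q)
            \<and> (length c = length a + 2 \<longrightarrow>
                 norm (q * prod_list a) < norm (d1 * d2 * prod_list c))"
  have dx: "norm (x * d1) < 1 \<and> norm (x * d2) < 1" if "norm x < \<sigma>" for x
  proof -
    have "norm x * norm y < 1" if "norm y < 1 / \<sigma>" for y :: complex
    proof -
      have "norm x * norm y \<le> \<sigma> * norm y"
        using \<open>norm x < \<sigma>\<close> by (intro mult_right_mono) auto
      also have "\<dots> < 1" using that sig by (simp add: field_simps)
      finally show ?thesis .
    qed
    then show ?thesis using dbound by (simp add: norm_mult)
  qed
  define p where "p = length c - length a - 2"
  \<comment> \<open>The variable is now \<open>\<sigma>\<close> / z: the entries of \<open>c\<close>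
    generate the poles inside the circle of radius \<open>\<sigma>\<close>, those from
    \<open>d1\<close>, \<open>d2\<close> lie outside. If \<open>length c = length a + 2\<close>, the
    convergence condition becomes the assumed bound on \<open>q * prod_list a\<close>.\<close>
  define T where "T = theta_quotient_term (f / d2) (f * d1) a c [] [d1, d2] q"
  define I where "I i = {..<length c} - {i}" for i
  define t where "t i n = qfin (c ! i * d1) q n * qfin (c ! i * d2) q n
                 * (\<Prod>x\<leftarrow>a. \<Prod>j<n. x - c ! i * q ^ (j + 1))
                 / (qfin q q n * (\<Prod>j\<in>I i. qfin (q * c ! i / c ! j) q n))
                 * ((-1) ^ n * q ^ (n choose 2)) ^ p
                 * (q * (q * c ! i) ^ p / (d1 * d2 * prod_list c)) ^ n" for i n
  define k where "k i = qtheta (f * c ! i * d1) q * qtheta (f / (c ! i * d2)) q * (\<Prod>x\<leftarrow>a. qinf (x / c ! i) q)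
        / (qinf (c ! i * d1) q * qinf (c ! i * d2) q * (\<Prod>j\<in>I i. qinf (c ! j / c ! i) q))" for i
  have T: "T i = (\<lambda>n. k i / qinf q q * t i n)" if i: "i < length c" for i
  proof
    fix n
    have x: "norm (c ! i * d1) < 1" "norm (c ! i * d2) < 1" using dx[of "c ! i"] cbound i by auto
    \<comment> \<open>Splitting off the finite products yields the numerator parameters
      \<open>c ! i * d1\<close> and \<open>c ! i * d2\<close> of the series in
      \<open>Jfun\<close>.\<close>
    have s: "qinf (d1 * (c ! i * q ^ n)) q = qinf (c ! i * d1) q / qfin (c ! i * d1) q n"
      "qinf (d2 * (c ! i * q ^ n)) q = qinf (c ! i * d2) q / qfin (c ! i * d2) q n"
      using qinf_shift_eq[OF q(2) x(1), of n] qinf_shift_eq[OF q(2) x(2), of n] by (simp_all add: mult_ac)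
    have base: "f / d2 / (f * d1) * q * (q * c ! i) ^ p / prod_list c = q * (q * c ! i) ^ p / (d1 * d2 * prod_list c)"
      using f d by simp
    show "T i n = k i / qinf q q * t i n"
      unfolding T_def theta_quotient_term_def Let_def p_def[symmetric] I_def[symmetric] base t_def k_def
      by (simp add: s mult_ac)
  qed
  define G where "G = (\<lambda>\<psi>. theta_quotient (f / d2) (f * d1) a c [] [d1, d2] q (of_real \<sigma> * exp (\<i> * of_real \<psi>)))"
  have summ: "summable (T i)" if "i < length c" for i
    unfolding T_def
    by (rule theta_quotient_integral(1)[where \<rho> = \<sigma>])
       (use q f d dbound sig cbound A that in \<open>auto simp: norm_mult norm_divide field_simps\<close>)
  have int: "integral {-pi..pi} G = 2 * of_real pi * (\<Sum>i<length c. \<Sum>n. T i n)"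
    unfolding T_def G_def
    by (rule theta_quotient_integral(2))
       (use q f d dbound sig cbound A in \<open>auto simp: norm_mult norm_divide field_simps\<close>)
  \<comment> \<open>Inverting the variable reverses the angle, and the symmetric interval makes the
    integral invariant under this reflection.\<close>
  have "integrand a c d1 d2 \<sigma> f q = (\<lambda>\<psi>. G (- \<psi>))"
    using f d sig
    by (intro ext) (simp add: G_def integrand_def theta_quotient_def qtheta_def Let_def exp_minus field_simps)
  then have "integral {-pi..pi} (integrand a c d1 d2 \<sigma> f q) = integral {-pi..pi} G"
    using Henstock_Kurzweil_Integration.integral_reflect_real[of pi "-pi" G] by simp
  also have "\<dots> = 2 * of_real pi * (\<Sum>i<length c. k i / qinf q q * (\<Sum>n. t i n))"
  proof -
    have "(\<Sum>n. T i n) = k i / qinf q q * (\<Sum>n. t i n)" if "i < length c" for i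
      using suminf_mult_const[of "k i / qinf q q" "t i"] summ[OF that] by (simp only: T[OF that])
    then show ?thesis unfolding int by simp
  qed
  also have "(\<Sum>i<length c. k i / qinf q q * (\<Sum>n. t i n)) = Jfun a c d1 d2 f q / qinf q q"
    by (simp add: Jfun_def Let_def k_def t_def I_def p_def sum_divide_distrib)
  finally show "integral {-pi..pi} (integrand a c d1 d2 \<sigma> f q)
                = 2 * pi / qinf q q * Jfun a c d1 d2 f q" by simp
qed

end
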